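(* Let $p(\cdot), q(\cdot), 1/\alpha(\cdot)\in \mathcal{P}(\mathbb R^n)$ be such that $1<p(\cdot)\leq q(\cdot)<\infty$. Let $\mathcal{D}$ be a dyadic lattice on $\mathbb{R}^n$. The following assertions hold. (1) Suppose that $M_{\mathcal{D}}$ is bounded on $L^{q'(\cdot)}(\mathbb R^n)$ and $1\in A_{1/\alpha(\cdot)}(\mathcal{D})$. If $C_{\downarrow}^{\alpha(\cdot)}(\mathcal{D}) < \infty$ and $M^{\alpha(\cdot)}_{\mathcal{D}}:L^{p(\cdot)}(\mathbb R^n)\to L^{q(\cdot)}(\mathbb R^n)$ is bounded, then $I^{\alpha(\cdot)}_{\mathcal{D}}:L^{p(\cdot)}(\mathbb R^n)\to L^{q(\cdot)}(\mathbb R^n)$ is bounded. (2) Suppose that $1\in A_{p(\cdot)}(\mathcal{D})\cap A_{q(\cdot)}(\mathcal{D})$ and $\alpha(\cdot) = \frac{1}{p(\cdot)}-\frac{1}{q(\cdot)}$. If $I^{\alpha(\cdot)}_{\mathcal{D}}:L^{p(\cdot)}(\mathbb R^n)\to L^{q(\cdot)}(\mathbb R^n)$ is bounded, then $C_{\downarrow}^{\alpha(\cdot)}(\mathcal{D}) < \infty$ and $M^{\alpha(\cdot)}_{\mathcal{D}}:L^{p(\cdot)}(\mathbb R^n)\to L^{q(\cdot)}(\mathbb R^n)$ is bounded.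
   Context: $\mathcal{P}(\mathbb{R}^n)$ is the set of measurable functions $p(\cdot):\mathbb{R}^n\to[1,\infty]$ (Lebesgue measure); pointwise relations between exponents are understood almost everywhere. With $1/\infty=0$, $1/0=\infty$, the condition $1/\alpha(\cdot)\in\mathcal P(\mathbb R^n)$ means that $\alpha:\mathbb{R}^n\to[0,1]$ is measurable. The conjugate exponent is given by $\frac1{p(\cdot)}+\frac1{p'(\cdot)}=1$. The norm of $L^{p(\cdot)}$ is $\|f\|_{L^{p(\cdot)}}=\inf\{\lambda>0:\rho_{p(\cdot)}(f/\lambda)\le1\}$, where $\rho_{p(\cdot)}(f)=\int_{\{p(\cdot)<\infty\}}|f(x)|^{p(x)}\,dx+\|f\|_{L^\infty(\{p(\cdot)=\infty\})}$. A dyadic lattice on $\mathbb R^n$ is a collection of cubes $\mathcal D=\bigcup_{k\in\mathbb Z}\mathcal D_k$ such that $Q\cap P\in\{Q,P,\emptyset\}$ for all $Q,P\in\mathcal D$, and, for all $k\in\mathbb Z$, $\mathcal D_k=\{Q\in\mathcal D:\ell(Q)=2^k\}$ ($\ell(Q)$ is the side length) and $\mathbb R^n=\bigcup_{Q\in\mathcal D_k}Q$. Write $\mathcal D(Q_0)=\{Q\in\mathcal D:Q\subset Q_0\}$ and $\langle\alpha\rangle_Q=\frac1{|Q|}\int_Q\alpha$. Define $$M_{\mathcal D}f=\sup_{Q\in\mathcal D}\frac{1_Q}{|Q|}\int_Q|f|,\quad M^{\alpha(\cdot)}_{\mathcal D}f=\sup_{Q\in\mathcal D}\frac{1_Q}{|Q|^{1-\langle\alpha\rangle_Q}}\int_Q|f|,\quad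 I^{\alpha(\cdot)}_{\mathcal D}f=\sum_{Q\in\mathcal D}\frac{1_Q}{|Q|^{1-\langle\alpha\rangle_Q}}\int_Qf,$$ the sum being understood pointwise whenever it is well-defined (for $f\ge0$ it takes values in $[0,\infty]$). Boundedness $Z\to Y$ means $\|Tf\|_Y\le C\|f\|_Z$ for all $f\in Z$ with a finite constant $C$. The packing constant is $$C_{\downarrow}^{\alpha(\cdot)}(\mathcal D)=\sup_{Q_0\in\mathcal D}\frac{\sum_{Q\in\mathcal D(Q_0)}|Q|^{1+\langle\alpha\rangle_Q}}{|Q_0|^{1+\langle\alpha\rangle_{Q_0}}}.$$ $1\in A_{s(\cdot)}(\mathcal D)$ means $\sup_{Q\in\mathcal D}\|1_Q\|_{L^{s(\cdot)}}\|1_Q\|_{L^{s'(\cdot)}}/|Q|<\infty$. *)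

theory Defs
  imports "HOL-Analysis.Analysis" "HOL-Probability.Essential_Supremum"
begin

section \<open>Variable exponents and variable Lebesgue spaces\<close>

text \<open>
  Exponents take values in \<^typ>\<open>ennreal\<close>, where \<open>1 / 0 = top\<close> and \<open>1 / top = 0\<close>.
\<close>

definition exponents :: "(real ^ 'n \<Rightarrow> ennreal) set" where
  "exponents = {p. p \<in> borel_measurable lebesgue \<and> (\<forall>x. 1 \<le> p x)}"

definition conj_exponent :: "(real ^ 'n \<Rightarrow> ennreal) \<Rightarrow> real ^ 'n \<Rightarrow> ennreal" where
  "conj_exponent p x = 1 / (1 - 1 / p x)"

text \<open>Used only for exponents \<open>r\<close> with \<open>1 \<le> r < top\<close>.\<close>

definition epowr :: "ennreal \<Rightarrow> ennreal \<Rightarrow> ennreal" where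
  "epowr t r = (if t = top then top else ennreal (enn2real t powr enn2real r))"

text \<open>
  The modular and the norm depend only on \<open>\<bar>f\<bar>\<close>. They are defined on functions with values in
  \<open>[0, \<infinity>]\<close>, because maximal functions may be infinite.
\<close>

definition modular :: "(real ^ 'n \<Rightarrow> ennreal) \<Rightarrow> (real ^ 'n \<Rightarrow> ennreal) \<Rightarrow> ennreal" where
  "modular p g =
     (\<integral>\<^sup>+x\<in>{x. p x < top}. epowr (g x) (p x) \<partial>lebesgue)
       + esssup (restrict_space lebesgue {x. p x = top}) g"

definition lnorm :: "(real ^ 'n \<Rightarrow> ennreal) \<Rightarrow> (real ^ 'n \<Rightarrow> ennreal) \<Rightarrow> ennreal" where
  "lnorm p g =
     (INF l\<in>{l::real. 0 < l \<and> modular p (\<lambda>x. g x / ennreal l) \<le> 1}. ennreal l)"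

definition Lspace :: "(real ^ 'n \<Rightarrow> ennreal) \<Rightarrow> (real ^ 'n \<Rightarrow> real) set" where
  "Lspace p = {f. f \<in> borel_measurable lebesgue \<and> lnorm p (\<lambda>x. ennreal \<bar>f x\<bar>) < top}"

text \<open>The argument \<open>T\<close> sends \<open>f\<close> to the modulus of the image of \<open>f\<close>.\<close>

definition bounded_op ::
  "((real ^ 'n \<Rightarrow> real) \<Rightarrow> real ^ 'n \<Rightarrow> ennreal) \<Rightarrow>
    (real ^ 'n \<Rightarrow> ennreal) \<Rightarrow> (real ^ 'n \<Rightarrow> ennreal) \<Rightarrow> bool" where
  "bounded_op T p q \<longleftrightarrow>
     (\<exists>C::real. \<forall>f\<in>Lspace p. lnorm q (T f) \<le> ennreal C * lnorm p (\<lambda>x. ennreal \<bar>f x\<bar>))"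


section \<open>Dyadic lattices\<close>

text \<open>Cubes are half-open, with sides parallel to the axes.\<close>

definition cube :: "real ^ 'n \<Rightarrow> real \<Rightarrow> (real ^ 'n) set" where
  "cube a l = {x. \<forall>i. a $ i \<le> x $ i \<and> x $ i < a $ i + l}"

definition generation :: "(real ^ 'n) set set \<Rightarrow> int \<Rightarrow> (real ^ 'n) set set" where
  "generation D k = {Q \<in> D. \<exists>a. Q = cube a (2 powi k)}"

definition dyadic_lattice :: "(real ^ 'n) set set \<Rightarrow> bool" where
  "dyadic_lattice D \<longleftrightarrow>
     D = (\<Union>k. generation D k) \<and>
     (\<forall>Q\<in>D. \<forall>P\<in>D. Q \<inter> P \<in> {Q, P, {}}) \<and>
     (\<forall>k. \<Union>(generation D k) = UNIV)"

definition vol :: "(real ^ 'n) set \<Rightarrow> real" where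
  "vol Q = measure lebesgue Q"

text \<open>\<open>enn2real\<close> loses nothing here, as \<open>\<alpha> \<le> 1\<close> in all uses.\<close>

definition mean :: "(real ^ 'n \<Rightarrow> ennreal) \<Rightarrow> (real ^ 'n) set \<Rightarrow> real" where
  "mean \<alpha> Q = enn2real ((\<integral>\<^sup>+x\<in>Q. \<alpha> x \<partial>lebesgue) / emeasure lebesgue Q)"

text \<open>The condition \<open>1 \<in> A\<^sub>s(D)\<close>.\<close>

definition one_in_A :: "(real ^ 'n) set set \<Rightarrow> (real ^ 'n \<Rightarrow> ennreal) \<Rightarrow> bool" where
  "one_in_A D s \<longleftrightarrow>
     (SUP Q\<in>D. lnorm s (indicator Q) * lnorm (conj_exponent s) (indicator Q) / ennreal (vol Q)) < top"

definition packing_const :: "(real ^ 'n) set set \<Rightarrow> (real ^ 'n \<Rightarrow> ennreal) \<Rightarrow> ennreal" where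
  "packing_const D \<alpha> =
     (SUP Q0\<in>D. (\<Sum>\<^sub>\<infinity>Q\<in>{Q \<in> D. Q \<subseteq> Q0}. ennreal (vol Q powr (1 + mean \<alpha> Q)))
                  / ennreal (vol Q0 powr (1 + mean \<alpha> Q0)))"


section \<open>Dyadic operators\<close>

definition maximal :: "(real ^ 'n) set set \<Rightarrow> (real ^ 'n \<Rightarrow> real) \<Rightarrow> real ^ 'n \<Rightarrow> ennreal" where
  "maximal D f x =
     (SUP Q\<in>D. indicator Q x * ((\<integral>\<^sup>+y\<in>Q. ennreal \<bar>f y\<bar> \<partial>lebesgue) / ennreal (vol Q)))"

definition frac_maximal ::
  "(real ^ 'n) set set \<Rightarrow> (real ^ 'n \<Rightarrow> ennreal) \<Rightarrow> (real ^ 'n \<Rightarrow> real) \<Rightarrow> real ^ 'n \<Rightarrow> ennreal" where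
  "frac_maximal D \<alpha> f x =
     (SUP Q\<in>D. indicator Q x *
        ((\<integral>\<^sup>+y\<in>Q. ennreal \<bar>f y\<bar> \<partial>lebesgue) / ennreal (vol Q powr (1 - mean \<alpha> Q))))"

text \<open>
  The coefficient of \<open>1\<^sub>Q\<close> in the fractional integral. The Bochner integral is meaningful for
  every \<open>f\<close> in a variable Lebesgue space, as such functions are integrable on cubes.
\<close>

definition frac_coeff ::
  "(real ^ 'n \<Rightarrow> ennreal) \<Rightarrow> (real ^ 'n \<Rightarrow> real) \<Rightarrow> (real ^ 'n) set \<Rightarrow> real" where
  "frac_coeff \<alpha> f Q = (LINT y:Q|lebesgue. f y) / vol Q powr (1 - mean \<alpha> Q)"

definition frac_pos ::
  "(real ^ 'n) set set \<Rightarrow> (real ^ 'n \<Rightarrow> ennreal) \<Rightarrow> (real ^ 'n \<Rightarrow> real) \<Rightarrow> real ^ 'n \<Rightarrow> ennreal" where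
  "frac_pos D \<alpha> f x = (\<Sum>\<^sub>\<infinity>Q\<in>D. indicator Q x * ennreal (frac_coeff \<alpha> f Q))"

definition frac_neg ::
  "(real ^ 'n) set set \<Rightarrow> (real ^ 'n \<Rightarrow> ennreal) \<Rightarrow> (real ^ 'n \<Rightarrow> real) \<Rightarrow> real ^ 'n \<Rightarrow> ennreal" where
  "frac_neg D \<alpha> f x = (\<Sum>\<^sub>\<infinity>Q\<in>D. indicator Q x * ennreal (- frac_coeff \<alpha> f Q))"

text \<open>
  The unordered sum over \<open>D\<close> makes sense in \<open>[-\<infinity>, \<infinity>]\<close> unless both its positive and its negative
  terms have infinite sum. Since \<open>ennreal\<close> sends negative reals to \<open>0\<close>, these two sums are
  \<open>frac_pos\<close> and \<open>frac_neg\<close>.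
\<close>

definition frac_integral_defined ::
  "(real ^ 'n) set set \<Rightarrow> (real ^ 'n \<Rightarrow> ennreal) \<Rightarrow> (real ^ 'n \<Rightarrow> real) \<Rightarrow> real ^ 'n \<Rightarrow> bool" where
  "frac_integral_defined D \<alpha> f x \<longleftrightarrow> frac_pos D \<alpha> f x < top \<or> frac_neg D \<alpha> f x < top"

definition frac_integral ::
  "(real ^ 'n) set set \<Rightarrow> (real ^ 'n \<Rightarrow> ennreal) \<Rightarrow> (real ^ 'n \<Rightarrow> real) \<Rightarrow> real ^ 'n \<Rightarrow> ereal" where
  "frac_integral D \<alpha> f x = enn2ereal (frac_pos D \<alpha> f x) - enn2ereal (frac_neg D \<alpha> f x)"

definition frac_integral_bounded ::
  "(real ^ 'n) set set \<Rightarrow> (real ^ 'n \<Rightarrow> ennreal) \<Rightarrow>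
    (real ^ 'n \<Rightarrow> ennreal) \<Rightarrow> (real ^ 'n \<Rightarrow> ennreal) \<Rightarrow> bool" where
  "frac_integral_bounded D \<alpha> p q \<longleftrightarrow>
     (\<forall>f\<in>Lspace p. AE x in lebesgue. frac_integral_defined D \<alpha> f x) \<and>
     bounded_op (\<lambda>f x. e2ennreal \<bar>frac_integral D \<alpha> f x\<bar>) p q"

end

theory Submission
  imports Defs
begin

text \<open>
  Throughout, \<open>\<langle>h\<rangle>\<^sub>Q\<close> denotes the average of \<open>h\<close> over the cube \<open>Q\<close>, and \<open>p'\<close>, \<open>q'\<close> are the conjugate
  exponents.

  The first assertion is a duality argument. For \<open>f, g \<ge> 0\<close> the pairing of the fractional integral
  of \<open>f\<close> with \<open>g\<close> is the sum over all \<open>Q\<close> of \<open>\<lambda>\<^sub>Q \<langle>f\<rangle>\<^sub>Q \<langle>g\<rangle>\<^sub>Q\<close>, where \<open>\<lambda>\<^sub>Q\<close> is the power of \<open>|Q|\<close> that occurs in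
  the packing condition. Starting from a cube \<open>Q\<close>, stop at the maximal subcubes on which the average
  of \<open>f\<close> or that of \<open>g\<close> exceeds four times its value on \<open>Q\<close>. The cubes that are not below a stopping
  cube contribute at most \<open>16 \<langle>f\<rangle>\<^sub>Q \<langle>g\<rangle>\<^sub>Q\<close> times the sum of their \<open>\<lambda>\<close>, which by packing is at most
  \<open>16 C \<lambda>\<^sub>Q \<langle>f\<rangle>\<^sub>Q \<langle>g\<rangle>\<^sub>Q\<close>. The stopping cubes fill at most half of \<open>Q\<close>, so this is absorbed by an
  integral over the rest of \<open>Q\<close> of the product of the fractional maximal function of \<open>f\<close> with the
  maximal function of \<open>g\<close>. Recursion into the stopping cubes (\<open>stopping_sum_le\<close>), started at the
  maximal members of a finite subfamily of the lattice (\<open>stopping_sum_le_total\<close>), shows that the pairing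
  is at most \<open>32 C\<close> times the integral of that product over the whole space. By Hoelder's
  inequality and the two maximal bounds, this is controlled by the norm of \<open>f\<close> in the space of
  exponent \<open>p\<close> times the norm of \<open>g\<close> in the space of exponent \<open>q'\<close>, and \<open>lnorm_le_dual\<close> turns the
  estimate into a norm bound.

  In the second assertion the bound for the fractional maximal operator holds because a supremum of
  nonnegative terms is at most their sum. For the packing condition, test the fractional integral on the
  indicator of a cube \<open>Q\<close>. The image is at least \<open>|P|\<close> to the power \<open>\<langle>\<alpha>\<rangle>\<^sub>P\<close>, summed over the subcubes
  \<open>P\<close> of \<open>Q\<close> that contain the point; integrating over \<open>Q\<close> gives the packing sum. Hoelder's inequality
  therefore bounds the packing sum by the product of the norms of the indicator of \<open>Q\<close> for the
  exponents \<open>p\<close> and \<open>q'\<close>. Under the \<open>A\<close> conditions these norms are at most constants times \<open>|Q|\<close> to the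
  powers \<open>\<langle>1/p\<rangle>\<^sub>Q\<close> and \<open>1 - \<langle>1/q\<rangle>\<^sub>Q\<close> (\<open>lnorm_indicator_le_powr_mean\<close>), and these two exponents add up
  to \<open>1 + \<langle>\<alpha>\<rangle>\<^sub>Q\<close>.
\<close>

section \<open>Variable Lebesgue spaces: Hoelder inequality and duality\<close>

text \<open>
  The relation is symmetric in the two exponents. It is required only almost everywhere, so that an
  exponent may be infinite or equal to one on a null set.
\<close>

definition conjugate_pair :: "(real ^ 'n \<Rightarrow> ennreal) \<Rightarrow> (real ^ 'n \<Rightarrow> ennreal) \<Rightarrow> bool" where
  "conjugate_pair p q \<longleftrightarrow>
     p \<in> borel_measurable lebesgue \<and> q \<in> borel_measurable lebesgue \<and>
     (AE x in lebesgue. 1 < p x \<and> p x < top \<and> 1 < q x \<and> q x < top \<and>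
        1 / enn2real (p x) + 1 / enn2real (q x) = 1)"

lemma conjugate_pair_sym: "conjugate_pair p q \<Longrightarrow> conjugate_pair q p"
  unfolding conjugate_pair_def by (auto elim!: eventually_mono simp: add.commute)

lemma conjugate_pair_conj_exponent:
  fixes q :: "real ^ 'n \<Rightarrow> ennreal"
  assumes [measurable]: "q \<in> borel_measurable lebesgue"
    and q: "AE x in lebesgue. 1 < q x \<and> q x < top"
  shows "conjugate_pair q (conj_exponent q)"
proof -
  have "1 < conj_exponent q x \<and> conj_exponent q x < top \<and>
      1 / enn2real (q x) + 1 / enn2real (conj_exponent q x) = 1"
    if qx: "1 < q x" "q x < top" for x
  proof -
    obtain r where r: "q x = ennreal r" "1 < r"
      using qx by (cases "q x") (auto simp: one_less_ennreal)
    have "1 - 1 / q x = ennreal (1 - 1 / r)"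
      using r by (simp add: divide_ennreal ennreal_minus flip: ennreal_1)
    also have "1 / ennreal (1 - 1 / r) = ennreal (r / (r - 1))"
      using r by (subst ennreal_1[symmetric], subst divide_ennreal) (auto simp: field_simps)
    finally have "conj_exponent q x = ennreal (r / (r - 1))"
      by (simp add: conj_exponent_def)
    then show ?thesis using r by (auto simp: one_less_ennreal field_simps)
  qed
  then have "AE x in lebesgue. 1 < q x \<and> q x < top \<and> 1 < conj_exponent q x \<and>
      conj_exponent q x < top \<and> 1 / enn2real (q x) + 1 / enn2real (conj_exponent q x) = 1"
    by (intro eventually_mono[OF q]) blast
  moreover have "conj_exponent q \<in> borel_measurable lebesgue"
    unfolding conj_exponent_def[abs_def] by measurable
  ultimately show ?thesis
    unfolding conjugate_pair_def by (simp del: AE_conj_iff)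
qed

lemma epowr_measurable[measurable]:
  assumes [measurable]: "f \<in> borel_measurable M" "p \<in> borel_measurable M"
  shows "(\<lambda>x. epowr (f x) (p x)) \<in> borel_measurable M"
  unfolding epowr_def by measurable

lemma epowr_mono: "s \<le> t \<Longrightarrow> epowr s r \<le> epowr t r"
  by (auto simp: epowr_def top_unique less_top[symmetric] intro!: ennreal_leI powr_mono2 enn2real_mono)

lemma epowr_ennreal: "0 \<le> s \<Longrightarrow> epowr (ennreal s) r = ennreal (s powr enn2real r)"
  by (simp add: epowr_def)

text \<open>
  For an almost everywhere finite exponent the essential supremum is taken over a null set, where
  every bound holds almost everywhere, so it vanishes.
\<close>

lemma modular_eq:
  fixes p g :: "real ^ 'n \<Rightarrow> ennreal"
  assumes [measurable]: "p \<in> borel_measurable lebesgue" "g \<in> borel_measurable lebesgue"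
    and p: "AE x in lebesgue. p x < top"
  shows "modular p g = (\<integral>\<^sup>+x. epowr (g x) (p x) \<partial>lebesgue)"
proof -
  let ?N = "{x. p x = top}"
  have "{x \<in> space lebesgue. p x = top} \<in> sets lebesgue" by measurable
  then have N: "?N \<in> sets lebesgue" by simp
  have "AE x in lebesgue. x \<notin> ?N" using p by (auto elim!: eventually_mono)
  then have "?N \<in> null_sets lebesgue"
    using N by (subst AE_iff_null_sets) auto
  then have "AE x in restrict_space lebesgue ?N. False"
    using N by (auto simp: AE_restrict_space_iff dest!: AE_not_in)
  then have "AE x in restrict_space lebesgue ?N. g x \<le> 0" by (auto elim: eventually_mono)
  moreover have "g \<in> borel_measurable (restrict_space lebesgue ?N)"
    by (rule measurable_restrict_space1) measurable
  ultimately have "esssup (restrict_space lebesgue ?N) g \<le> 0"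
    by (intro esssup_I)
  then have "esssup (restrict_space lebesgue ?N) g = 0" by simp
  moreover have "(\<integral>\<^sup>+x\<in>{x. p x < top}. epowr (g x) (p x) \<partial>lebesgue) =
      (\<integral>\<^sup>+x. epowr (g x) (p x) \<partial>lebesgue)"
    using p by (intro nn_integral_cong_AE) (auto elim!: eventually_mono)
  ultimately show ?thesis by (simp add: modular_def)
qed

lemma lnorm_le: "0 < l \<Longrightarrow> modular p (\<lambda>x. g x / ennreal l) \<le> 1 \<Longrightarrow> lnorm p g \<le> ennreal l"
  unfolding lnorm_def by (rule INF_lower) auto

text \<open>
  The infimum in \<^const>\<open>lnorm\<close> runs over an upward closed set, because the modular is monotone.
  Hence every number above the norm is admissible.
\<close>

lemma modular_le_one:
  fixes p g :: "real ^ 'n \<Rightarrow> ennreal"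
  assumes [measurable]: "p \<in> borel_measurable lebesgue" "g \<in> borel_measurable lebesgue"
    and p: "AE x in lebesgue. p x < top" and l: "lnorm p g < ennreal l"
  shows "(\<integral>\<^sup>+x. epowr (g x / ennreal l) (p x) \<partial>lebesgue) \<le> 1"
proof -
  obtain k where k: "0 < k" "modular p (\<lambda>x. g x / ennreal k) \<le> 1" "ennreal k < ennreal l"
    using l unfolding lnorm_def INF_less_iff by auto
  then have kl: "k < l" by (simp add: ennreal_less_iff)
  have "(\<integral>\<^sup>+x. epowr (g x / ennreal l) (p x) \<partial>lebesgue) \<le>
      (\<integral>\<^sup>+x. epowr (g x / ennreal k) (p x) \<partial>lebesgue)"
    using k kl by (intro nn_integral_mono epowr_mono)
      (simp add: divide_ennreal_def inverse_ennreal mult_left_mono le_imp_inverse_le)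
  also have "\<dots> = modular p (\<lambda>x. g x / ennreal k)"
    using p by (subst modular_eq) auto
  finally show ?thesis using k by simp
qed

lemma lnorm_mono:
  fixes p g h :: "real ^ 'n \<Rightarrow> ennreal"
  assumes [measurable]: "p \<in> borel_measurable lebesgue" "g \<in> borel_measurable lebesgue"
      "h \<in> borel_measurable lebesgue"
    and p: "AE x in lebesgue. p x < top" and le: "AE x in lebesgue. g x \<le> h x"
  shows "lnorm p g \<le> lnorm p h"
proof -
  have "modular p (\<lambda>x. g x / ennreal l) \<le> modular p (\<lambda>x. h x / ennreal l)" for l
    using le p by (simp add: modular_eq)
      (intro nn_integral_mono_AE, auto elim!: eventually_mono intro!: epowr_mono divide_right_mono_ennreal)
  then show ?thesis
    unfolding lnorm_def by (intro INF_superset_mono) (auto intro: order_trans)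
qed

text \<open>
  The weights \<open>1/a\<close> and \<open>1/b\<close> of Young's inequality would vary from point to point with the exponents.
  Bounding them by \<open>1\<close> leaves two modulars after integration, whence the constant \<open>2\<close> in
  \<open>Hoelder_lnorm\<close>.
\<close>

lemma young_without_weights:
  fixes s t :: ennreal
  assumes "1 < a" "a < top" "1 < b" "b < top" "1 / enn2real a + 1 / enn2real b = 1"
  shows "s * t \<le> epowr s a + epowr t b"
proof (cases "s = top \<or> t = top")
  case True
  then show ?thesis by (auto simp: epowr_def)
next
  case False
  then obtain u v where uv: "s = ennreal u" "t = ennreal v" "0 \<le> u" "0 \<le> v"
    by (cases s; cases t) auto
  have ab: "1 < enn2real a" "1 < enn2real b"
    using assms by (cases a; cases b; auto)+
  have "u * v \<le> u powr enn2real a / enn2real a + v powr enn2real b / enn2real b"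
    using Youngs_inequality[of "enn2real a" "enn2real b" u v] ab assms uv by auto
  also have "\<dots> \<le> u powr enn2real a + v powr enn2real b"
    using ab by (intro add_mono) (auto simp: divide_le_eq mult_le_cancel_left1)
  finally show ?thesis
    using uv by (simp add: epowr_ennreal flip: ennreal_mult' ennreal_plus)
qed

text \<open>
  After division by numbers slightly larger than the norms both modulars are at most \<open>1\<close>, so the
  pointwise Young inequality integrates to \<open>2\<close>. The enlargement \<open>e\<close>, which tends to \<open>0\<close>, covers the
  case of a vanishing norm.
\<close>

lemma Hoelder_lnorm:
  fixes p q u v :: "real ^ 'n \<Rightarrow> ennreal"
  assumes pq: "conjugate_pair p q"
    and [measurable]: "u \<in> borel_measurable lebesgue" "v \<in> borel_measurable lebesgue"
    and fin: "lnorm p u < top" "lnorm q v < top"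
  shows "(\<integral>\<^sup>+x. u x * v x \<partial>lebesgue) \<le> 2 * (lnorm p u * lnorm q v)"
proof -
  have [measurable]: "p \<in> borel_measurable lebesgue" "q \<in> borel_measurable lebesgue"
    and ae: "AE x in lebesgue. 1 < p x \<and> p x < top \<and> 1 < q x \<and> q x < top \<and>
        1 / enn2real (p x) + 1 / enn2real (q x) = 1"
    using pq by (auto simp: conjugate_pair_def)
  have ae1: "AE x in lebesgue. p x < top" and ae2: "AE x in lebesgue. q x < top"
    using ae by (auto elim!: eventually_mono)
  obtain a b where ab: "lnorm p u = ennreal a" "lnorm q v = ennreal b" "0 \<le> a" "0 \<le> b"
    using fin by (cases "lnorm p u"; cases "lnorm q v") auto
  have *: "(\<integral>\<^sup>+x. u x * v x \<partial>lebesgue) \<le> ennreal (2 * ((a + e) * (b + e)))" if e: "0 < e" for e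
  proof -
    let ?a = "ennreal (a + e)" and ?b = "ennreal (b + e)"
    have nz: "?a \<noteq> 0" "?b \<noteq> 0" using ab e by auto
    have 1: "(\<integral>\<^sup>+x. epowr (u x / ?a) (p x) \<partial>lebesgue) \<le> 1"
      using ab e ae1 by (intro modular_le_one) (auto simp: ennreal_less_iff)
    have 2: "(\<integral>\<^sup>+x. epowr (v x / ?b) (q x) \<partial>lebesgue) \<le> 1"
      using ab e ae2 by (intro modular_le_one) (auto simp: ennreal_less_iff)
    have "(\<integral>\<^sup>+x. u x * v x \<partial>lebesgue) = (\<integral>\<^sup>+x. (?a * ?b) * ((u x / ?a) * (v x / ?b)) \<partial>lebesgue)"
    proof (rule nn_integral_cong)
      fix x
      have "u x = ?a * (u x / ?a)" "v x = ?b * (v x / ?b)"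
        using nz by (simp_all add: ennreal_times_divide ennreal_mult_divide_eq mult.commute)
      then show "u x * v x = (?a * ?b) * ((u x / ?a) * (v x / ?b))"
        by (metis mult.assoc mult.left_commute)
    qed
    also have "\<dots> = (?a * ?b) * (\<integral>\<^sup>+x. (u x / ?a) * (v x / ?b) \<partial>lebesgue)"
      by (subst nn_integral_cmult) auto
    also have "\<dots> \<le> (?a * ?b) * (\<integral>\<^sup>+x. epowr (u x / ?a) (p x) + epowr (v x / ?b) (q x) \<partial>lebesgue)"
      using ae by (intro mult_left_mono nn_integral_mono_AE)
        (auto elim: eventually_elim2 intro!: young_without_weights)
    also have "\<dots> \<le> (?a * ?b) * (1 + 1)"
      using 1 2 by (subst nn_integral_add) (simp_all add: mult_left_mono add_mono del: one_add_one)
    also have "\<dots> = ennreal (2 * ((a + e) * (b + e)))"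
      using ab e by (simp add: ennreal_mult mult.commute)
    finally show ?thesis .
  qed
  have "((\<lambda>e. ennreal (2 * ((a + e) * (b + e)))) \<longlongrightarrow> ennreal (2 * ((a + 0) * (b + 0)))) (at_right 0)"
    by (intro tendsto_intros)
  then have "(\<integral>\<^sup>+x. u x * v x \<partial>lebesgue) \<le> ennreal (2 * ((a + 0) * (b + 0)))"
    by (rule tendsto_lowerbound) (auto intro!: * eventually_at_right_less[THEN eventually_mono])
  then show ?thesis using ab by (simp add: ennreal_mult)
qed

text \<open>
  Pointwise \<open>t \<le> 1 + t powr r\<close> for \<open>r \<ge> 1\<close>, and the constant \<open>1\<close> is integrable on a set of finite
  measure.
\<close>

lemma Lspace_integrable_on:
  fixes p :: "real ^ 'n \<Rightarrow> ennreal"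
  assumes f: "f \<in> Lspace p" and [measurable]: "p \<in> borel_measurable lebesgue"
    and p: "AE x in lebesgue. 1 < p x \<and> p x < top"
    and S[measurable]: "S \<in> sets lebesgue" and fin: "emeasure lebesgue S < top"
  shows "(\<integral>\<^sup>+x\<in>S. ennreal \<bar>f x\<bar> \<partial>lebesgue) < top"
proof -
  have [measurable]: "f \<in> borel_measurable lebesgue" and nf: "lnorm p (\<lambda>x. ennreal \<bar>f x\<bar>) < top"
    using f by (auto simp: Lspace_def)
  have p1: "AE x in lebesgue. p x < top" using p by (auto elim!: eventually_mono)
  obtain l where l: "0 < l" "lnorm p (\<lambda>x. ennreal \<bar>f x\<bar>) < ennreal l"
  proof (cases "lnorm p (\<lambda>x. ennreal \<bar>f x\<bar>)")
    case (real r)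
    then show ?thesis by (intro that[of "r + 1"]) (auto simp: ennreal_less_iff)
  qed (use nf in auto)
  have "(\<integral>\<^sup>+x\<in>S. ennreal \<bar>f x\<bar> \<partial>lebesgue) \<le>
      (\<integral>\<^sup>+x. ennreal l * (indicator S x + epowr (ennreal \<bar>f x\<bar> / ennreal l) (p x)) \<partial>lebesgue)"
    using p
  proof (intro nn_integral_mono_AE, elim eventually_mono)
    fix x assume px: "1 < p x \<and> p x < top"
    let ?t = "\<bar>f x\<bar> / l"
    have 1: "1 \<le> enn2real (p x)" using px by (cases "p x") auto
    have "?t \<le> 1 + ?t powr enn2real (p x)"
    proof (cases "?t \<le> 1")
      case False
      then have "?t powr 1 \<le> ?t powr enn2real (p x)" using 1 by (intro powr_mono) auto
      then show ?thesis using False l by simp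
    qed (use l in \<open>auto intro: add_increasing2\<close>)
    then have "\<bar>f x\<bar> \<le> l * (1 + ?t powr enn2real (p x))"
      using l by (simp add: field_simps)
    then have "ennreal \<bar>f x\<bar> \<le> ennreal l * (1 + epowr (ennreal \<bar>f x\<bar> / ennreal l) (p x))"
      using l by (simp add: divide_ennreal epowr_ennreal flip: ennreal_1 ennreal_plus ennreal_mult')
    then show "ennreal \<bar>f x\<bar> * indicator S x \<le>
        ennreal l * (indicator S x + epowr (ennreal \<bar>f x\<bar> / ennreal l) (p x))"
      by (auto simp: indicator_def)
  qed
  also have "\<dots> = ennreal l * (emeasure lebesgue S + (\<integral>\<^sup>+x. epowr (ennreal \<bar>f x\<bar> / ennreal l) (p x) \<partial>lebesgue))"
    by (simp add: nn_integral_cmult nn_integral_add)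
  also have "\<dots> \<le> ennreal l * (emeasure lebesgue S + 1)"
    using p1 l by (intro mult_left_mono add_mono modular_le_one) auto
  also have "\<dots> < top" using fin by (simp add: ennreal_mult_less_top)
  finally show ?thesis .
qed

text \<open>
  The norm is recovered from pairings with real functions in the unit ball of the conjugate space.
  If the modular \<open>m\<close> of \<open>h/l\<close> is finite and exceeds \<open>1\<close>, then \<open>g = (h/l) powr (p - 1) / m\<close> has
  conjugate modular at most \<open>1\<close>, since \<open>m powr q \<ge> m\<close>, while its pairing with \<open>h\<close> equals \<open>l\<close>. So for
  \<open>l > S\<close> a finite modular is at most \<open>1\<close>. The function \<open>h\<close> may be infinite and \<open>p\<close> unbounded;
  finiteness of \<open>m\<close> is obtained by truncating \<open>h\<close> to bounded values, to a ball, and to the set where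
  \<open>p\<close> is bounded, and monotone convergence removes the truncation.
\<close>

lemma lnorm_le_dual:
  fixes p q h :: "real ^ 'n \<Rightarrow> ennreal"
  assumes pq: "conjugate_pair p q" and h[measurable]: "h \<in> borel_measurable lebesgue"
    and dual: "\<And>g :: real ^ 'n \<Rightarrow> real. g \<in> borel_measurable lebesgue \<Longrightarrow> (\<And>x. 0 \<le> g x) \<Longrightarrow>
      lnorm q (\<lambda>x. ennreal (g x)) \<le> 1 \<Longrightarrow> (\<integral>\<^sup>+x. h x * ennreal (g x) \<partial>lebesgue) \<le> S"
  shows "lnorm p h \<le> S"
proof -
  have [measurable]: "p \<in> borel_measurable lebesgue" "q \<in> borel_measurable lebesgue"
    and ae: "AE x in lebesgue. 1 < p x \<and> p x < top \<and> 1 < q x \<and> q x < top \<and>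
        1 / enn2real (p x) + 1 / enn2real (q x) = 1"
    using pq by (auto simp: conjugate_pair_def)
  have ae1: "AE x in lebesgue. p x < top" and ae2: "AE x in lebesgue. q x < top"
    using ae by (auto elim!: eventually_mono)
  define hk :: "nat \<Rightarrow> real ^ 'n \<Rightarrow> real" where
    "hk k x = (if x \<in> ball 0 (real k) \<and> p x \<le> ennreal (real k) then enn2real (min (h x) (ennreal (real k))) else 0)" for k x
  have hk_nn: "0 \<le> hk k x" for k x by (simp add: hk_def)
  have hk_le_h: "ennreal (hk k x) \<le> h x" for k x
    by (auto simp: hk_def min_def ennreal_enn2real_if top_unique)
  have hk_le_k: "hk k x \<le> real k" for k x
    by (auto simp: hk_def intro!: enn2real_leI)
  have [measurable]: "ball (0 :: real ^ 'n) r \<in> sets lebesgue" for r by simp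
  have [measurable]: "hk k \<in> borel_measurable lebesgue" for k
    unfolding hk_def by measurable
  have bound: "(\<integral>\<^sup>+x. epowr (ennreal (hk k x / l)) (p x) \<partial>lebesgue) \<le> 1"
    if l: "S < ennreal l" for k l
  proof (rule ccontr)
    assume neg: "\<not> ?thesis"
    have l0: "0 < l" using l by (cases "0 < l") (auto simp: ennreal_neg not_less)
    let ?F = "\<lambda>x. (hk k x / l) powr enn2real (p x)"
    have Fe: "epowr (ennreal (hk k x / l)) (p x) = ennreal (?F x)" for x
      using l0 hk_nn by (simp add: epowr_ennreal)
    define M where "M = (max 1 (real k / l)) powr real k"
    have FM: "ennreal (?F x) \<le> ennreal M * indicator (ball 0 (real k)) x" for x
    proof (cases "x \<in> ball 0 (real k) \<and> p x \<le> ennreal (real k)")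
      case True
      have "enn2real (p x) \<le> real k" using True by (auto intro!: enn2real_leI)
      moreover have "hk k x / l \<le> max 1 (real k / l)"
        using l0 hk_le_k[of k x] by (intro max.coboundedI2 divide_right_mono) auto
      then have "?F x \<le> (max 1 (real k / l)) powr enn2real (p x)"
        using l0 hk_nn[of k x] by (intro powr_mono2) auto
      moreover have "(max 1 (real k / l)) powr enn2real (p x) \<le> M"
        unfolding M_def using \<open>enn2real (p x) \<le> real k\<close> by (intro powr_mono) auto
      ultimately have "?F x \<le> M"
        by simp
      then show ?thesis using True by (auto intro!: ennreal_leI)
    qed (auto simp: hk_def)
    have "(\<integral>\<^sup>+x. ennreal (?F x) \<partial>lebesgue) \<le> (\<integral>\<^sup>+x. ennreal M * indicator (ball (0 :: real ^ 'n) (real k)) x \<partial>lebesgue)"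
      by (rule nn_integral_mono) (rule FM)
    also have "\<dots> = ennreal M * emeasure lebesgue (ball (0 :: real ^ 'n) (real k))"
      by (subst nn_integral_cmult_indicator) auto
    also have "\<dots> < top"
      using emeasure_bounded_finite[OF bounded_ball, of "0 :: real ^ 'n" "real k"] by (simp add: ennreal_mult_less_top)
    finally obtain m where m: "(\<integral>\<^sup>+x. ennreal (?F x) \<partial>lebesgue) = ennreal m" "0 \<le> m"
      by (auto simp: less_top_ennreal)
    have m1: "1 < m" using neg m by (auto simp: Fe not_le one_less_ennreal)
    define g where "g x = (hk k x / l) powr (enn2real (p x) - 1) / m" for x
    have [measurable]: "g \<in> borel_measurable lebesgue" unfolding g_def by measurable
    have g0: "0 \<le> g x" for x using m1 by (simp add: g_def)
    have "(\<integral>\<^sup>+x. epowr (ennreal (g x)) (q x) \<partial>lebesgue) \<le> (\<integral>\<^sup>+x. ennreal (?F x) / ennreal m \<partial>lebesgue)"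
      using ae
    proof (intro nn_integral_mono_AE, elim eventually_mono)
      fix x assume x: "1 < p x \<and> p x < top \<and> 1 < q x \<and> q x < top \<and>
        1 / enn2real (p x) + 1 / enn2real (q x) = 1"
      let ?p = "enn2real (p x)" and ?q = "enn2real (q x)"
      have pq1: "1 < ?p" "1 < ?q" using x by (cases "p x"; cases "q x"; auto simp: one_less_ennreal)+
      then have e: "(?p - 1) * ?q = ?p" using x by (auto simp: field_simps)
      have "m powr 1 \<le> m powr ?q" using m1 pq1 by (intro powr_mono) auto
      moreover have "(b powr (?p - 1) / m) powr ?q = b powr ?p / m powr ?q" for b
        using m1 by (subst powr_divide) (auto simp: powr_powr e)
      ultimately have "g x powr ?q \<le> ?F x / m"
        using m1 unfolding g_def by (simp add: divide_left_mono del: powr_divide)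
      then show "epowr (ennreal (g x)) (q x) \<le> ennreal (?F x) / ennreal m"
        using m1 g0 by (simp add: epowr_ennreal divide_ennreal ennreal_leI)
    qed
    also have "\<dots> = 1"
      using m m1 by (simp add: nn_integral_divide)
    finally have "lnorm q (\<lambda>x. ennreal (g x)) \<le> ennreal 1"
      using ae2 by (intro lnorm_le) (simp_all add: modular_eq divide_ennreal_def)
    then have "(\<integral>\<^sup>+x. h x * ennreal (g x) \<partial>lebesgue) \<le> S"
      by (intro dual g0) auto
    moreover have "ennreal l = ennreal (l / m) * (\<integral>\<^sup>+x. ennreal (?F x) \<partial>lebesgue)"
      using m m1 l0 by (simp flip: ennreal_mult')
    moreover have "\<dots> = (\<integral>\<^sup>+x. ennreal (l / m) * ennreal (?F x) \<partial>lebesgue)"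
      by (subst nn_integral_cmult) auto
    moreover have "\<dots> = (\<integral>\<^sup>+x. ennreal (hk k x) * ennreal (g x) \<partial>lebesgue)"
    proof (rule nn_integral_cong)
      fix x
      have "l / m * ?F x = hk k x * g x"
      proof (cases "hk k x = 0")
        case False
        then show ?thesis using l0 m1 hk_nn[of k x]
          by (simp add: g_def powr_diff field_simps)
      qed (simp add: g_def)
      then show "ennreal (l / m) * ennreal (?F x) = ennreal (hk k x) * ennreal (g x)"
        using l0 m1 hk_nn[of k x] by (simp flip: ennreal_mult')
    qed
    moreover have "\<dots> \<le> (\<integral>\<^sup>+x. h x * ennreal (g x) \<partial>lebesgue)"
      by (intro nn_integral_mono mult_right_mono hk_le_h) auto
    ultimately show False using l by (auto dest: leD)
  qed
  have "lnorm p h \<le> ennreal l" if l: "S < ennreal l" for l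
  proof -
    have l0: "0 < l" using l by (cases "0 < l") (auto simp: ennreal_neg not_less)
    have inc: "incseq (\<lambda>k x. epowr (ennreal (hk k x / l)) (p x))"
    proof (rule incseq_SucI, rule le_funI, rule epowr_mono, rule ennreal_leI, rule divide_right_mono)
      fix k x
      have "ennreal (real k) \<le> ennreal (real (Suc k))" by (intro ennreal_leI) simp
      then show "hk k x \<le> hk (Suc k) x"
        by (auto simp: hk_def min_less_iff_disj intro!: enn2real_mono min.mono intro: order_trans simp del: ennreal_of_nat_eq_real_of_nat of_nat_Suc)
    qed (use l0 in auto)
    have "(\<integral>\<^sup>+x. epowr (h x / ennreal l) (p x) \<partial>lebesgue) \<le>
        (\<integral>\<^sup>+x. (SUP k. epowr (ennreal (hk k x / l)) (p x)) \<partial>lebesgue)"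
      using ae
    proof (intro nn_integral_mono_AE, elim eventually_mono)
      fix x assume x: "1 < p x \<and> p x < top \<and> 1 < q x \<and> q x < top \<and>
        1 / enn2real (p x) + 1 / enn2real (q x) = 1"
      let ?p = "enn2real (p x)"
      have p1: "1 < ?p" using x by (cases "p x") (auto simp: one_less_ennreal)
      obtain N where N: "norm x < real N" "?p < real N" "l < real N"
        using reals_Archimedean2[of "max (norm x) (max ?p l)"] by auto
      have pN: "p x \<le> ennreal (real k)" if "N \<le> k" for k
        using x N that by (cases "p x") (auto intro!: ennreal_leI)
      have hk: "hk k x = enn2real (min (h x) (ennreal (real k)))" if "N \<le> k" for k
        using N pN[OF that] that by (simp add: hk_def)
      show "epowr (h x / ennreal l) (p x) \<le> (SUP k. epowr (ennreal (hk k x / l)) (p x))"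
      proof (cases "h x")
        case (real r)
        obtain k where k: "r < real k" "N \<le> k"
          using reals_Archimedean2[of "max r (real N)"] by auto
        then have "hk k x = r" using real by (simp add: hk min_def ennreal_leI)
        then have "epowr (h x / ennreal l) (p x) = epowr (ennreal (hk k x / l)) (p x)"
          using real l0 by (simp add: divide_ennreal)
        then show ?thesis by (auto intro!: SUP_upper2[of k])
      next
        case top
        \<comment> \<open>Here \<open>h x\<close> is infinite, so the truncations are \<open>k\<close>, and \<open>k / l \<ge> 1\<close> gives \<open>(k / l) powr p \<ge> k / l\<close>.\<close>
        have "ennreal B \<le> (SUP k. epowr (ennreal (hk k x / l)) (p x))" for B
        proof -
          obtain k where k: "max B 1 * l < real k" "N \<le> k"
            using reals_Archimedean2[of "max (max B 1 * l) (real N)"] by auto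
          then have kl: "max B 1 \<le> real k / l" using l0 by (simp add: pos_le_divide_eq del: max.bounded_iff)
          have "B \<le> (real k / l) powr 1" using kl l0 by simp
          also have "\<dots> \<le> (real k / l) powr ?p" using kl p1 by (intro powr_mono) auto
          finally have "ennreal B \<le> epowr (ennreal (hk k x / l)) (p x)"
            using k top l0 by (simp add: hk epowr_ennreal ennreal_leI)
          then show ?thesis by (auto intro!: SUP_upper2[of k])
        qed
        note * = this
        have "(SUP k. epowr (ennreal (hk k x / l)) (p x)) = top"
        proof (cases "SUP k. epowr (ennreal (hk k x / l)) (p x)")
          case (real r)
          with *[of "r + 1"] show ?thesis by simp
        qed
        then show ?thesis by (metis top_greatest)
      qed
    qed
    also have "\<dots> = (SUP k. \<integral>\<^sup>+x. epowr (ennreal (hk k x / l)) (p x) \<partial>lebesgue)"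
      using inc by (intro nn_integral_monotone_convergence_SUP) auto
    also have "\<dots> \<le> 1" by (intro SUP_least bound l)
    finally show ?thesis
      using l0 ae1 by (intro lnorm_le) (simp_all add: modular_eq)
  qed
  note * = this
  show ?thesis
  proof (rule dense_ge)
    fix y assume "S < y"
    then show "lnorm p h \<le> y" using * by (cases y) auto
  qed
qed

section \<open>A stopping argument in finite laminar families\<close>

definition laminar :: "'a set set \<Rightarrow> bool" where
  "laminar F \<longleftrightarrow> (\<forall>P\<in>F. \<forall>Q\<in>F. P \<subseteq> Q \<or> Q \<subseteq> P \<or> P \<inter> Q = {})"

definition maximal_sets :: "'a set set \<Rightarrow> 'a set set" where
  "maximal_sets F = {Q \<in> F. \<forall>P\<in>F. Q \<subseteq> P \<longrightarrow> P = Q}"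

lemma maximal_sets_subset: "maximal_sets F \<subseteq> F"
  by (auto simp: maximal_sets_def)

lemma subset_of_maximal_set:
  assumes "finite F" "Q \<in> F"
  obtains P where "P \<in> maximal_sets F" "Q \<subseteq> P"
  using finite_has_maximal2[OF assms] unfolding maximal_sets_def by blast

lemma laminar_mono: "laminar F \<Longrightarrow> G \<subseteq> F \<Longrightarrow> laminar G"
  unfolding laminar_def by blast

lemma disjoint_maximal_sets:
  assumes "laminar F"
  shows "disjoint (maximal_sets F)"
proof (rule disjointI)
  fix P Q assume PQ: "P \<in> maximal_sets F" "Q \<in> maximal_sets F" "P \<noteq> Q"
  then have "\<not> P \<subseteq> Q" "\<not> Q \<subseteq> P" by (auto simp: maximal_sets_def)
  then show "P \<inter> Q = {}" using assms PQ by (auto simp: laminar_def maximal_sets_def)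
qed

text \<open>
  A nonempty set lies below at most one member of a disjoint family.
\<close>

lemma sum_below_disjoint_sets:
  fixes h :: "'a set \<Rightarrow> 'b::comm_monoid_add"
  assumes "finite F" "finite B" "disjoint B" "{} \<notin> F"
  shows "(\<Sum>Q\<in>{Q\<in>F. \<exists>P\<in>B. Q \<subseteq> P}. h Q) = (\<Sum>P\<in>B. \<Sum>Q\<in>{Q\<in>F. Q \<subseteq> P}. h Q)"
proof -
  have "{Q\<in>F. \<exists>P\<in>B. Q \<subseteq> P} = (\<Union>P\<in>B. {Q\<in>F. Q \<subseteq> P})" by blast
  moreover have "{Q\<in>F. Q \<subseteq> P} \<inter> {Q\<in>F. Q \<subseteq> P'} = {}" if "P \<in> B" "P' \<in> B" "P \<noteq> P'" for P P'
  proof -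
    have "P \<inter> P' = {}" using that assms(3) by (auto simp: disjoint_def)
    moreover have "Q \<noteq> {}" if "Q \<in> F" for Q using that assms(4) by auto
    ultimately show ?thesis by blast
  qed
  ultimately show ?thesis
    using assms by (simp add: sum.UNION_disjoint)
qed

definition average :: "'a measure \<Rightarrow> ('a \<Rightarrow> ennreal) \<Rightarrow> 'a set \<Rightarrow> ennreal" where
  "average M f Q = (\<integral>\<^sup>+x\<in>Q. f x \<partial>M) / emeasure M Q"

lemma nn_integral_eq_average:
  assumes "0 < emeasure M Q" "emeasure M Q < top"
  shows "(\<integral>\<^sup>+x\<in>Q. f x \<partial>M) = average M f Q * emeasure M Q"
  using assms by (simp add: average_def ennreal_divide_times)

lemma sum_nn_integral_disjoint:
  assumes "finite B" "disjoint B" "B \<subseteq> sets M" and [measurable]: "f \<in> borel_measurable M"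
  shows "(\<Sum>P\<in>B. \<integral>\<^sup>+x\<in>P. f x \<partial>M) = (\<integral>\<^sup>+x\<in>\<Union>B. f x \<partial>M)"
proof -
  have "(\<Sum>P\<in>B. \<integral>\<^sup>+x\<in>P. f x \<partial>M) = (\<integral>\<^sup>+x. (\<Sum>P\<in>B. f x * indicator P x) \<partial>M)"
    using assms by (subst nn_integral_sum) auto
  also have "\<dots> = (\<integral>\<^sup>+x\<in>\<Union>B. f x \<partial>M)"
    using assms(1,2) by (simp add: indicator_UN_disjoint[of B "\<lambda>x. x", simplified] disjoint_family_on_def
        disjoint_def sum_distrib_left)
  finally show ?thesis .
qed

text \<open>
  This is Chebyshev's inequality for averages: the members of \<open>B\<close> carry at least \<open>4 \<langle>f\<rangle>\<^sub>Q\<close> times their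
  measure of the integral of \<open>f\<close>, and the total available is \<open>\<langle>f\<rangle>\<^sub>Q\<close> times the measure of \<open>Q\<close>. If
  \<open>\<langle>f\<rangle>\<^sub>Q = 0\<close>, nothing can be cancelled, but then \<open>B\<close> is empty.
\<close>

lemma measure_large_average_le:
  assumes B: "finite B" "disjoint B" "B \<subseteq> sets M" "\<Union>B \<subseteq> Q"
    and Q: "Q \<in> sets M" "0 < emeasure M Q" "emeasure M Q < top"
    and f[measurable]: "f \<in> borel_measurable M" and fin: "(\<integral>\<^sup>+x\<in>Q. f x \<partial>M) < top"
    and pos: "\<And>P. P \<in> B \<Longrightarrow> 0 < emeasure M P"
    and large: "\<And>P. P \<in> B \<Longrightarrow> 4 * average M f Q < average M f P"
  shows "4 * (\<Sum>P\<in>B. emeasure M P) \<le> emeasure M Q"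
proof -
  let ?a = "average M f Q"
  have a_fin: "?a < top"
    using fin Q by (auto simp: average_def ennreal_divide_eq_top_iff less_top[symmetric])
  have "(4 * ?a) * emeasure M P \<le> (\<integral>\<^sup>+x\<in>P. f x \<partial>M)" if P: "P \<in> B" for P
  proof -
    have "emeasure M P \<le> emeasure M Q" using P B Q by (intro emeasure_mono) auto
    then have "(\<integral>\<^sup>+x\<in>P. f x \<partial>M) = average M f P * emeasure M P"
      using pos[OF P] Q by (intro nn_integral_eq_average) auto
    then show ?thesis
      using large[OF P] by (auto intro!: mult_right_mono)
  qed
  then have "(\<Sum>P\<in>B. (4 * ?a) * emeasure M P) \<le> (\<Sum>P\<in>B. \<integral>\<^sup>+x\<in>P. f x \<partial>M)"
    by (intro sum_mono)
  also have "\<dots> = (\<integral>\<^sup>+x\<in>\<Union>B. f x \<partial>M)"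
    using B by (intro sum_nn_integral_disjoint) auto
  also have "\<dots> \<le> (\<integral>\<^sup>+x\<in>Q. f x \<partial>M)"
    using B by (intro nn_integral_mono mult_left_mono) (auto simp: indicator_def)
  also have "\<dots> = ?a * emeasure M Q"
    using Q by (intro nn_integral_eq_average) auto
  finally have le: "?a * (4 * (\<Sum>P\<in>B. emeasure M P)) \<le> ?a * emeasure M Q"
    by (simp add: mult_ac flip: sum_distrib_left sum_distrib_right)
  show ?thesis
  proof (cases "?a = 0")
    case True
    then have 0: "(\<integral>\<^sup>+x\<in>Q. f x \<partial>M) = 0" using nn_integral_eq_average[of M Q f] Q by simp
    have "B = {}"
    proof (rule ccontr)
      assume "B \<noteq> {}"
      then obtain P where P: "P \<in> B" by auto
      have "(\<integral>\<^sup>+x\<in>P. f x \<partial>M) \<le> (\<integral>\<^sup>+x\<in>Q. f x \<partial>M)"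
        using B P by (intro nn_integral_mono mult_left_mono) (auto simp: indicator_def)
      then have "average M f P = 0" using 0 by (simp add: average_def)
      then show False using large[OF P] by simp
    qed
    then show ?thesis by simp
  next
    case False
    then show ?thesis using le a_fin by (subst (asm) ennreal_mult_le_mult_iff) auto
  qed
qed

text \<open>
  The induction is on the number of members of \<open>F\<close> below \<open>Q\<close>. It descends to the maximal members on
  which the average of \<open>f\<close> or of \<open>g\<close> jumps by more than a factor \<open>4\<close>; their union \<open>\<Union>B\<close> has at most
  half the measure of \<open>Q\<close>. The sets below \<open>\<Union>B\<close> are handled by the induction hypothesis and consume
  the integral of \<open>\<Theta>\<close> over \<open>\<Union>B\<close>; the others are handled by packing and consume the integral of
  \<open>\<Theta>\<close> over the rest \<open>E\<close>. The constant is \<open>32 = 4 * 4 * 2\<close>: one factor \<open>4\<close> for each average and the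
  factor \<open>2\<close> for passing from \<open>Q\<close> to \<open>E\<close>. Finiteness of \<open>F\<close> makes the recursion terminate and
  guarantees maximal members, which a dyadic lattice itself does not have.
\<close>

lemma stopping_sum_le:
  fixes lam :: "'a set \<Rightarrow> ennreal" and f g \<Theta> :: "'a \<Rightarrow> ennreal"
  assumes F: "finite F" "laminar F" "F \<subseteq> sets M"
    and pos: "\<And>Q. Q \<in> F \<Longrightarrow> 0 < emeasure M Q \<and> emeasure M Q < top"
    and [measurable]: "f \<in> borel_measurable M" "g \<in> borel_measurable M" "\<Theta> \<in> borel_measurable M"
    and fin: "\<And>Q. Q \<in> F \<Longrightarrow> (\<integral>\<^sup>+x\<in>Q. f x \<partial>M) < top" "\<And>Q. Q \<in> F \<Longrightarrow> (\<integral>\<^sup>+x\<in>Q. g x \<partial>M) < top"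
    and packing: "\<And>Q. Q \<in> F \<Longrightarrow> (\<Sum>P\<in>{P\<in>F. P \<subseteq> Q}. lam P) \<le> C * lam Q"
    and dom: "\<And>Q x. Q \<in> F \<Longrightarrow> x \<in> Q \<Longrightarrow>
      lam Q * average M f Q * average M g Q \<le> emeasure M Q * \<Theta> x"
    and Q: "Q \<in> F"
  shows "(\<Sum>P\<in>{P\<in>F. P \<subseteq> Q}. lam P * average M f P * average M g P) \<le>
    32 * C * (\<integral>\<^sup>+x\<in>Q. \<Theta> x \<partial>M)"
  using Q
proof (induction "card {P\<in>F. P \<subseteq> Q}" arbitrary: Q rule: less_induct)
  case less
  note Q = \<open>Q \<in> F\<close>
  let ?t = "\<lambda>P. lam P * average M f P * average M g P"
  have Qm[measurable]: "Q \<in> sets M" using Q F by auto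
  have F_ne: "{} \<notin> F" using pos by force
  define bad where "bad = {P\<in>F. P \<subseteq> Q \<and>
    (4 * average M f Q < average M f P \<or> 4 * average M g Q < average M g P)}"
  define B where "B = maximal_sets bad"
  have bad: "finite bad" "laminar bad"
    using F by (auto simp: bad_def intro: laminar_mono)
  have "B \<subseteq> bad" by (simp add: B_def maximal_sets_subset)
  then have BF: "B \<subseteq> F" and BQ: "\<And>P. P \<in> B \<Longrightarrow> P \<subseteq> Q" by (auto simp: bad_def)
  have Bfin: "finite B" and Bdis: "disjoint B" and Bm: "B \<subseteq> sets M"
    using bad BF F finite_subset[OF \<open>B \<subseteq> bad\<close>] by (auto simp: B_def disjoint_maximal_sets)
  have [measurable]: "\<Union>B \<in> sets M" using Bfin Bm by (intro sets.finite_Union) auto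
  have QnB: "Q \<notin> B"
  proof -
    have "\<not> 4 * y < y" for y :: ennreal by (cases y) (auto simp: ennreal_less_iff not_less simp flip: ennreal_numeral ennreal_mult')
    then show ?thesis using \<open>B \<subseteq> bad\<close> by (auto simp: bad_def)
  qed
  define Bf where "Bf = {P\<in>B. 4 * average M f Q < average M f P}"
  define Bg where "Bg = {P\<in>B. 4 * average M g Q < average M g P}"
  have BU: "B = Bf \<union> Bg" using \<open>B \<subseteq> bad\<close> by (auto simp: Bf_def Bg_def bad_def)
  have f4: "4 * (\<Sum>P\<in>Bf. emeasure M P) \<le> emeasure M Q"
    using Bfin Bdis Bm BQ BF pos[OF Q] pos fin(1)[OF Q]
    by (intro measure_large_average_le[of Bf M Q f]) (auto simp: Bf_def intro: pairwise_subset[OF Bdis])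
  have g4: "4 * (\<Sum>P\<in>Bg. emeasure M P) \<le> emeasure M Q"
    using Bfin Bdis Bm BQ BF pos[OF Q] pos fin(2)[OF Q]
    by (intro measure_large_average_le[of Bg M Q g]) (auto simp: Bg_def intro: pairwise_subset[OF Bdis])
  define E where "E = Q - \<Union>B"
  have [measurable]: "E \<in> sets M" by (simp add: E_def)
  \<comment> \<open>Each of the two kinds of stopping sets fills at most a quarter of \<open>Q\<close>.\<close>
  have half: "emeasure M Q \<le> 2 * emeasure M E"
  proof -
    have "emeasure M Q = emeasure M E + emeasure M (\<Union>B)"
      using BQ by (subst plus_emeasure) (auto simp: E_def intro!: arg_cong[where f="emeasure M"])
    also have "emeasure M (\<Union>B) = (\<Sum>P\<in>B. emeasure M P)"
      using Bfin Bdis Bm sum_emeasure[of "\<lambda>x. x" B M] by (auto simp: disjoint_family_on_def disjoint_def)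
    also have "\<dots> \<le> (\<Sum>P\<in>Bf. emeasure M P) + (\<Sum>P\<in>Bg. emeasure M P)"
    proof -
      have "finite Bf" "finite Bg" using Bfin by (auto simp: Bf_def Bg_def)
      then have "(\<Sum>P\<in>Bf. emeasure M P) + (\<Sum>P\<in>Bg. emeasure M P) =
          (\<Sum>P\<in>B. emeasure M P) + (\<Sum>P\<in>Bf \<inter> Bg. emeasure M P)"
        unfolding BU by (rule sum.union_inter[symmetric])
      then show ?thesis by simp
    qed
    finally have 1: "emeasure M Q \<le> emeasure M E + ((\<Sum>P\<in>Bf. emeasure M P) + (\<Sum>P\<in>Bg. emeasure M P))"
      by (simp add: add_left_mono)
    obtain m where m: "emeasure M Q = ennreal m" "0 \<le> m"
      using pos[OF Q] by (cases "emeasure M Q") auto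
    have "emeasure M E \<le> emeasure M Q" by (intro emeasure_mono) (auto simp: E_def)
    then obtain e where e: "emeasure M E = ennreal e" "0 \<le> e"
      using m by (cases "emeasure M E") (auto simp: top_unique)
    obtain u where u: "(\<Sum>P\<in>Bf. emeasure M P) = ennreal u" "0 \<le> u"
      using f4 m by (cases "\<Sum>P\<in>Bf. emeasure M P") (auto simp: top_unique ennreal_mult_top)
    obtain v where v: "(\<Sum>P\<in>Bg. emeasure M P) = ennreal v" "0 \<le> v"
      using g4 m by (cases "\<Sum>P\<in>Bg. emeasure M P") (auto simp: top_unique ennreal_mult_top)
    show ?thesis
      using 1 f4 g4 m e u v by (simp flip: ennreal_numeral ennreal_mult' ennreal_plus)
  qed
  define A where "A = ?t Q"
  have good: "(\<Sum>P\<in>{P\<in>F. P \<subseteq> Q \<and> \<not> (\<exists>P'\<in>B. P \<subseteq> P')}. ?t P) \<le> 32 * C * (\<integral>\<^sup>+x\<in>E. \<Theta> x \<partial>M)"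
  proof -
    have "(\<Sum>P\<in>{P\<in>F. P \<subseteq> Q \<and> \<not> (\<exists>P'\<in>B. P \<subseteq> P')}. ?t P) \<le>
        (\<Sum>P\<in>{P\<in>F. P \<subseteq> Q \<and> \<not> (\<exists>P'\<in>B. P \<subseteq> P')}. 16 * average M f Q * average M g Q * lam P)"
    proof (rule sum_mono)
      fix P assume P: "P \<in> {P\<in>F. P \<subseteq> Q \<and> \<not> (\<exists>P'\<in>B. P \<subseteq> P')}"
      then have "P \<notin> bad"
        using subset_of_maximal_set[OF bad(1), of P] by (auto simp: B_def)
      then have "average M f P \<le> 4 * average M f Q" "average M g P \<le> 4 * average M g Q"
        using P by (auto simp: bad_def not_less)
      then have "?t P \<le> lam P * (4 * average M f Q) * (4 * average M g Q)"
        by (intro mult_mono) auto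
      then show "?t P \<le> 16 * average M f Q * average M g Q * lam P"
        by (simp add: mult_ac)
    qed
    also have "\<dots> \<le> (\<Sum>P\<in>{P\<in>F. P \<subseteq> Q}. 16 * average M f Q * average M g Q * lam P)"
      using F by (intro sum_mono2) auto
    also have "\<dots> = 16 * average M f Q * average M g Q * (\<Sum>P\<in>{P\<in>F. P \<subseteq> Q}. lam P)"
      by (simp add: sum_distrib_left)
    also have "\<dots> \<le> 16 * average M f Q * average M g Q * (C * lam Q)"
      by (intro mult_left_mono packing Q) auto
    also have "\<dots> = 16 * C * A" by (simp add: A_def mult_ac)
    \<comment> \<open>The bound \<open>dom\<close> holds at every point of \<open>Q\<close>, so it can be integrated over \<open>E\<close> alone.\<close>
    also have "A \<le> 2 * (\<integral>\<^sup>+x\<in>E. \<Theta> x \<partial>M)"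
    proof -
      have "A * emeasure M Q \<le> A * (2 * emeasure M E)"
        by (intro mult_left_mono half) auto
      also have "\<dots> = 2 * (\<integral>\<^sup>+x\<in>E. A \<partial>M)"
        by (simp add: nn_integral_cmult_indicator mult_ac)
      also have "\<dots> \<le> 2 * (\<integral>\<^sup>+x\<in>E. emeasure M Q * \<Theta> x \<partial>M)"
        using dom[OF Q] by (intro mult_left_mono nn_integral_mono) (auto simp: E_def A_def indicator_def)
      also have "\<dots> = emeasure M Q * (2 * (\<integral>\<^sup>+x\<in>E. \<Theta> x \<partial>M))"
        by (simp only: mult.assoc, subst nn_integral_cmult) (auto simp: mult.left_commute)
      finally have "emeasure M Q * A \<le> emeasure M Q * (2 * (\<integral>\<^sup>+x\<in>E. \<Theta> x \<partial>M))"
        by (simp add: mult_ac)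
      then show ?thesis using pos[OF Q] by (subst (asm) ennreal_mult_le_mult_iff) auto
    qed
    then have "16 * C * A \<le> 16 * C * (2 * (\<integral>\<^sup>+x\<in>E. \<Theta> x \<partial>M))"
      by (rule mult_left_mono) simp
    finally show ?thesis by (simp add: mult_ac)
  qed
  have sub: "(\<Sum>P'\<in>{P'\<in>F. P' \<subseteq> P}. ?t P') \<le> 32 * C * (\<integral>\<^sup>+x\<in>P. \<Theta> x \<partial>M)" if P: "P \<in> B" for P
  proof (rule less.hyps)
    have "P \<subset> Q" using P QnB BQ by auto
    then show "card {P'\<in>F. P' \<subseteq> P} < card {P\<in>F. P \<subseteq> Q}"
      using F Q by (intro psubset_card_mono) auto
    show "P \<in> F" using P BF by auto
  qed
  have "{P\<in>F. P \<subseteq> Q} = {P\<in>F. P \<subseteq> Q \<and> \<not> (\<exists>P'\<in>B. P \<subseteq> P')} \<union> {P\<in>F. \<exists>P'\<in>B. P \<subseteq> P'}"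
    using BQ by blast
  then have "(\<Sum>P\<in>{P\<in>F. P \<subseteq> Q}. ?t P) =
      (\<Sum>P\<in>{P\<in>F. P \<subseteq> Q \<and> \<not> (\<exists>P'\<in>B. P \<subseteq> P')}. ?t P) + (\<Sum>P\<in>{P\<in>F. \<exists>P'\<in>B. P \<subseteq> P'}. ?t P)"
    using F by (simp only:) (subst sum.union_disjoint, auto)
  also have "(\<Sum>P\<in>{P\<in>F. \<exists>P'\<in>B. P \<subseteq> P'}. ?t P) = (\<Sum>P'\<in>B. \<Sum>P\<in>{P\<in>F. P \<subseteq> P'}. ?t P)"
    using F Bfin Bdis F_ne by (intro sum_below_disjoint_sets)
  also have "\<dots> \<le> (\<Sum>P\<in>B. 32 * C * (\<integral>\<^sup>+x\<in>P. \<Theta> x \<partial>M))"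
    by (intro sum_mono sub)
  also have "\<dots> = 32 * C * (\<integral>\<^sup>+x\<in>\<Union>B. \<Theta> x \<partial>M)"
    using Bfin Bdis Bm by (simp add: sum_nn_integral_disjoint flip: sum_distrib_left)
  finally have "(\<Sum>P\<in>{P\<in>F. P \<subseteq> Q}. ?t P) \<le>
      32 * C * (\<integral>\<^sup>+x\<in>E. \<Theta> x \<partial>M) + 32 * C * (\<integral>\<^sup>+x\<in>\<Union>B. \<Theta> x \<partial>M)"
    using good by (auto intro: order_trans add_mono)
  also have "\<dots> = 32 * C * ((\<integral>\<^sup>+x\<in>E. \<Theta> x \<partial>M) + (\<integral>\<^sup>+x\<in>\<Union>B. \<Theta> x \<partial>M))"
    by (simp add: distrib_left)
  also have "(\<integral>\<^sup>+x\<in>E. \<Theta> x \<partial>M) + (\<integral>\<^sup>+x\<in>\<Union>B. \<Theta> x \<partial>M) = (\<integral>\<^sup>+x. \<Theta> x * indicator E x + \<Theta> x * indicator (\<Union>B) x \<partial>M)"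
    by (subst nn_integral_add) auto
  also have "\<dots> = (\<integral>\<^sup>+x\<in>Q. \<Theta> x \<partial>M)"
    using BQ by (intro nn_integral_cong) (auto simp: E_def indicator_def)
  finally show ?case .
qed

text \<open>
  The maximal members of \<open>F\<close> are disjoint and every member lies below one of them, so the local
  estimates add up.
\<close>

lemma stopping_sum_le_total:
  fixes lam :: "'a set \<Rightarrow> ennreal" and f g \<Theta> :: "'a \<Rightarrow> ennreal"
  assumes F: "finite F" "laminar F" "F \<subseteq> sets M"
    and pos: "\<And>Q. Q \<in> F \<Longrightarrow> 0 < emeasure M Q \<and> emeasure M Q < top"
    and meas[measurable]: "f \<in> borel_measurable M" "g \<in> borel_measurable M" "\<Theta> \<in> borel_measurable M"
    and fin: "\<And>Q. Q \<in> F \<Longrightarrow> (\<integral>\<^sup>+x\<in>Q. f x \<partial>M) < top" "\<And>Q. Q \<in> F \<Longrightarrow> (\<integral>\<^sup>+x\<in>Q. g x \<partial>M) < top"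
    and packing: "\<And>Q. Q \<in> F \<Longrightarrow> (\<Sum>P\<in>{P\<in>F. P \<subseteq> Q}. lam P) \<le> C * lam Q"
    and dom: "\<And>Q x. Q \<in> F \<Longrightarrow> x \<in> Q \<Longrightarrow>
      lam Q * average M f Q * average M g Q \<le> emeasure M Q * \<Theta> x"
  shows "(\<Sum>P\<in>F. lam P * average M f P * average M g P) \<le> 32 * C * (\<integral>\<^sup>+x. \<Theta> x \<partial>M)"
proof -
  let ?t = "\<lambda>P. lam P * average M f P * average M g P" and ?B = "maximal_sets F"
  have F_ne: "{} \<notin> F" using pos by force
  have B: "finite ?B" "disjoint ?B" "?B \<subseteq> sets M"
    using F maximal_sets_subset[of F] by (auto intro: finite_subset disjoint_maximal_sets)
  have "F = {P\<in>F. \<exists>P'\<in>?B. P \<subseteq> P'}"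
    using subset_of_maximal_set[OF F(1)] by blast
  then have "(\<Sum>P\<in>F. ?t P) = (\<Sum>P'\<in>?B. \<Sum>P\<in>{P\<in>F. P \<subseteq> P'}. ?t P)"
    using sum_below_disjoint_sets[OF F(1) B(1,2) F_ne, of ?t] by simp
  also have "\<dots> \<le> (\<Sum>P\<in>?B. 32 * C * (\<integral>\<^sup>+x\<in>P. \<Theta> x \<partial>M))"
  proof (rule sum_mono)
    fix P assume "P \<in> ?B"
    then have "P \<in> F" using maximal_sets_subset by blast
    then show "(\<Sum>P\<in>{P'\<in>F. P' \<subseteq> P}. ?t P) \<le> 32 * C * (\<integral>\<^sup>+x\<in>P. \<Theta> x \<partial>M)"
      by (intro stopping_sum_le F pos meas fin packing dom)
  qed
  also have "\<dots> = 32 * C * (\<integral>\<^sup>+x\<in>\<Union>?B. \<Theta> x \<partial>M)"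
    using B by (simp add: sum_nn_integral_disjoint flip: sum_distrib_left)
  also have "\<dots> \<le> 32 * C * (\<integral>\<^sup>+x. \<Theta> x \<partial>M)"
    by (intro mult_left_mono nn_integral_mono) (auto simp: indicator_def)
  finally show ?thesis .
qed

section \<open>Unordered sums of extended nonnegative reals\<close>

lemma infsum_ennreal_eq_suminf:
  fixes f :: "'a \<Rightarrow> ennreal"
  assumes "countable I" "infinite I"
  shows "(\<Sum>\<^sub>\<infinity>i\<in>I. f i) = (\<Sum>n. f (from_nat_into I n))"
proof -
  have "(\<Sum>\<^sub>\<infinity>i\<in>I. f i) = (\<Sum>\<^sub>\<infinity>n\<in>UNIV. f (from_nat_into I n))"
    by (rule infsum_reindex_bij_betw[symmetric, OF bij_betw_from_nat_into[OF assms]])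
  moreover have "((\<lambda>n. f (from_nat_into I n)) has_sum (\<Sum>\<^sub>\<infinity>n\<in>UNIV. f (from_nat_into I n))) UNIV"
    by (intro has_sum_infsum nonneg_summable_on_complete) auto
  ultimately show ?thesis
    using has_sum_imp_sums sums_unique by metis
qed

lemma borel_measurable_infsum_ennreal:
  fixes f :: "'i \<Rightarrow> 'a \<Rightarrow> ennreal"
  assumes "countable I" and [measurable]: "\<And>i. i \<in> I \<Longrightarrow> f i \<in> borel_measurable M"
  shows "(\<lambda>x. \<Sum>\<^sub>\<infinity>i\<in>I. f i x) \<in> borel_measurable M"
proof (cases "finite I")
  case False
  then have "from_nat_into I n \<in> I" for n by (intro from_nat_into) auto
  then show ?thesis
    using False assms by (simp add: infsum_ennreal_eq_suminf)
qed simp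

lemma nn_integral_infsum:
  fixes f :: "'i \<Rightarrow> 'a \<Rightarrow> ennreal"
  assumes "countable I" and [measurable]: "\<And>i. i \<in> I \<Longrightarrow> f i \<in> borel_measurable M"
  shows "(\<integral>\<^sup>+x. (\<Sum>\<^sub>\<infinity>i\<in>I. f i x) \<partial>M) = (\<Sum>\<^sub>\<infinity>i\<in>I. \<integral>\<^sup>+x. f i x \<partial>M)"
proof (cases "finite I")
  case True
  then show ?thesis by (simp add: nn_integral_sum)
next
  case False
  then have "from_nat_into I n \<in> I" for n by (intro from_nat_into) auto
  then show ?thesis
    using False assms by (simp add: infsum_ennreal_eq_suminf nn_integral_suminf)
qed

lemma infsum_ennreal_le:
  fixes f :: "'i \<Rightarrow> ennreal"
  assumes "\<And>F. finite F \<Longrightarrow> F \<subseteq> I \<Longrightarrow> (\<Sum>i\<in>F. f i) \<le> S"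
  shows "(\<Sum>\<^sub>\<infinity>i\<in>I. f i) \<le> S"
  using assms by (subst nonneg_infsum_complete) (auto intro!: SUP_least)

lemma sum_le_infsum_ennreal:
  fixes f :: "'i \<Rightarrow> ennreal"
  assumes "finite F" "F \<subseteq> I"
  shows "(\<Sum>i\<in>F. f i) \<le> (\<Sum>\<^sub>\<infinity>i\<in>I. f i)"
  using assms by (subst nonneg_infsum_complete) (auto intro!: SUP_upper2)

lemma infsum_ennreal_mono:
  fixes f g :: "'i \<Rightarrow> ennreal"
  assumes "\<And>i. i \<in> I \<Longrightarrow> f i \<le> g i"
  shows "(\<Sum>\<^sub>\<infinity>i\<in>I. f i) \<le> (\<Sum>\<^sub>\<infinity>i\<in>I. g i)"
  using assms by (intro infsum_mono nonneg_summable_on_complete) auto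

lemma infsum_ennreal_mono_set:
  fixes f :: "'i \<Rightarrow> ennreal"
  assumes "I \<subseteq> J"
  shows "(\<Sum>\<^sub>\<infinity>i\<in>I. f i) \<le> (\<Sum>\<^sub>\<infinity>i\<in>J. f i)"
  using assms by (intro infsum_ennreal_le sum_le_infsum_ennreal) auto

lemma infsum_ennreal_cmult:
  fixes f :: "'i \<Rightarrow> ennreal"
  shows "c * (\<Sum>\<^sub>\<infinity>i\<in>I. f i) = (\<Sum>\<^sub>\<infinity>i\<in>I. c * f i)"
proof -
  have "c * (\<Sum>\<^sub>\<infinity>i\<in>I. f i) = (SUP F\<in>{F. finite F \<and> F \<subseteq> I}. c * (\<Sum>i\<in>F. f i))"
    by (subst nonneg_infsum_complete) (auto intro!: SUP_mult_left_ennreal)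
  then show ?thesis
    by (subst (asm) sum_distrib_left) (simp add: nonneg_infsum_complete)
qed

section \<open>Cubes and dyadic lattices\<close>

lemma cube_measurable[measurable]: "cube a l \<in> sets lebesgue"
proof -
  have "cube a l = (\<Inter>i. {x. a $ i \<le> x $ i}) \<inter> (\<Inter>i. {x. x $ i < a $ i + l})"
    by (auto simp: cube_def)
  moreover have "closed (\<Inter>i. {x. a $ i \<le> x $ i})"
    by (intro closed_INT ballI closed_Collect_le continuous_intros)
  moreover have "open (\<Inter>i. {x. x $ i < a $ i + l})"
    by (intro open_INT ballI open_Collect_less continuous_intros finite)
  ultimately have "cube a l \<in> sets lborel"
    by (simp add: borel_closed borel_open sets.Int)
  then show ?thesis by (rule sets_completionI_sets)
qed

lemma box_subset_cube: "box a (a + (\<chi> i. l)) \<subseteq> cube a l"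
  by (auto simp: cube_def mem_box_cart less_imp_le)

lemma cube_subset_cbox: "cube a l \<subseteq> cbox a (a + (\<chi> i. l))"
  by (auto simp: cube_def mem_box_cart less_imp_le)

lemma box_cube_nonempty: "0 < l \<Longrightarrow> box a (a + (\<chi> i. l)) \<noteq> ({} :: (real ^ 'n) set)"
  by (simp add: interval_ne_empty_cart)

lemma cube_volume:
  fixes a :: "real ^ 'n"
  assumes "0 < l"
  shows "0 < vol (cube a l)" "emeasure lebesgue (cube a l) = ennreal (vol (cube a l))"
proof -
  have fin: "emeasure lebesgue (cube a l) < top"
    using fmeasurableD2[OF bounded_set_imp_lmeasurable[OF bounded_subset[OF bounded_cbox cube_subset_cbox] cube_measurable]]
    by (simp add: less_top[symmetric])
  then show eq: "emeasure lebesgue (cube a l) = ennreal (vol (cube a l))"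
    by (simp add: vol_def emeasure_eq_ennreal_measure less_top)
  have "\<not> negligible (box a (a + (\<chi> i. l)))"
    using assms by (intro open_not_negligible box_cube_nonempty) auto
  then have "cube a l \<notin> null_sets lebesgue"
    using negligible_subset[OF _ box_subset_cube[of a l]] by (auto simp: negligible_iff_null_sets)
  then have "emeasure lebesgue (cube a l) \<noteq> 0" by auto
  then show "0 < vol (cube a l)"
    unfolding eq by (simp add: vol_def less_le)
qed

text \<open>
  If \<open>b\<close> were smaller than \<open>a\<close> in coordinate \<open>j\<close>, the point \<open>a\<close> with its \<open>j\<close>-th coordinate moved to the
  excluded end \<open>b\<^sub>j + l\<close> would lie in the first cube only.
\<close>

lemma cube_subset_imp_eq:
  fixes a b :: "real ^ 'n"
  assumes "0 < l" and sub: "cube a l \<subseteq> cube b l"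
  shows "a = b"
proof (rule ccontr)
  assume "a \<noteq> b"
  then obtain j where j: "a $ j \<noteq> b $ j" by (auto simp: vec_eq_iff)
  have "a \<in> cube b l" using sub assms(1) by (auto simp: cube_def)
  then have d: "b $ j < a $ j" "a $ j < b $ j + l" using j by (auto simp: cube_def less_le)
  define x where "x = (\<chi> i. if i = j then b $ j + l else a $ i)"
  have "x \<in> cube a l" using d assms(1) by (auto simp: cube_def x_def)
  moreover have "x \<notin> cube b l" by (auto simp: cube_def x_def intro!: exI[of _ j])
  ultimately show False using sub by auto
qed

lemma dyadic_lattice_cube:
  assumes "dyadic_lattice D" "Q \<in> D"
  obtains a k where "Q = cube a (2 powi k)"
proof -
  have "Q \<in> (\<Union>k. generation D k)" using assms unfolding dyadic_lattice_def by auto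
  then show ?thesis using that by (auto simp: generation_def)
qed

lemma dyadic_lattice_measurable: "dyadic_lattice D \<Longrightarrow> Q \<in> D \<Longrightarrow> Q \<in> sets lebesgue"
  by (metis cube_measurable dyadic_lattice_cube)

lemma dyadic_lattice_vol_pos: "dyadic_lattice D \<Longrightarrow> Q \<in> D \<Longrightarrow> 0 < vol Q"
  by (metis cube_volume dyadic_lattice_cube zero_less_power_int zero_less_numeral)

lemma dyadic_lattice_emeasure:
  "dyadic_lattice D \<Longrightarrow> Q \<in> D \<Longrightarrow> emeasure lebesgue Q = ennreal (vol Q)"
  by (metis cube_volume dyadic_lattice_cube zero_less_power_int zero_less_numeral)

lemma dyadic_lattice_laminar: "dyadic_lattice D \<Longrightarrow> laminar D"
  unfolding dyadic_lattice_def laminar_def by blast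

text \<open>
  Cubes of one generation that share a point are nested and of equal size, hence equal. So each
  generation injects into a countable dense set.
\<close>

lemma countable_dyadic_lattice:
  fixes D :: "(real ^ 'n) set set"
  assumes D: "dyadic_lattice D"
  shows "countable D"
proof -
  obtain S :: "(real ^ 'n) set" where S: "countable S" "\<And>X. open X \<Longrightarrow> X \<noteq> {} \<Longrightarrow> \<exists>d\<in>S. d \<in> X"
    by (rule countable_dense_setE) blast
  have "countable (generation D k)" for k
  proof -
    have "\<exists>d\<in>S. d \<in> Q" if Q: "Q \<in> generation D k" for Q
    proof -
      obtain a where a: "Q = cube a (2 powi k)" using Q by (auto simp: generation_def)
      have "\<exists>d\<in>S. d \<in> box a (a + (\<chi> i. 2 powi k))"
        by (intro S box_cube_nonempty) auto
      then show ?thesis using a box_subset_cube by blast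
    qed
    then obtain d where d: "\<And>Q. Q \<in> generation D k \<Longrightarrow> d Q \<in> S \<and> d Q \<in> Q" by metis
    have "inj_on d (generation D k)"
    proof (rule inj_onI)
      fix P Q assume PQ: "P \<in> generation D k" "Q \<in> generation D k" "d P = d Q"
      then have "d P \<in> P \<inter> Q" using d[of P] d[of Q] by auto
      moreover have "P \<in> D" "Q \<in> D" using PQ by (auto simp: generation_def)
      ultimately have "P \<subseteq> Q \<or> Q \<subseteq> P"
        using dyadic_lattice_laminar[OF D] by (auto simp: laminar_def)
      moreover obtain a b where "P = cube a (2 powi k)" "Q = cube b (2 powi k)"
        using PQ by (auto simp: generation_def)
      ultimately show "P = Q" using cube_subset_imp_eq[of "2 powi k"] by auto
    qed
    moreover have "countable (d ` generation D k)"
      using d by (intro countable_subset[OF _ S(1)]) auto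
    ultimately show ?thesis by (rule countable_image_inj_on[rotated])
  qed
  then have "countable (\<Union>k. generation D k)" by auto
  then show ?thesis using D unfolding dyadic_lattice_def by auto
qed

section \<open>Fractional integrals under a packing condition\<close>

text \<open>
  This is the series of the fractional integral for a density with values in \<open>[0, \<infinity>]\<close>, where it is
  always defined. For signed \<open>f\<close> the potential of \<open>\<bar>f\<bar>\<close> dominates both the positive and the negative
  part of the series, so it decides convergence and size at once.
\<close>

definition potential ::
  "(real ^ 'n) set set \<Rightarrow> (real ^ 'n \<Rightarrow> ennreal) \<Rightarrow> (real ^ 'n \<Rightarrow> ennreal) \<Rightarrow> real ^ 'n \<Rightarrow> ennreal" where
  "potential D \<alpha> u x =
     (\<Sum>\<^sub>\<infinity>Q\<in>D. indicator Q x * ((\<integral>\<^sup>+y\<in>Q. u y \<partial>lebesgue) / ennreal (vol Q powr (1 - mean \<alpha> Q))))"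

context
  fixes D :: "(real ^ 'n) set set"
  assumes D: "dyadic_lattice D"
begin

lemma lattice_sum_measurable[measurable]:
  fixes c :: "(real ^ 'n) set \<Rightarrow> ennreal"
  assumes "D' \<subseteq> D"
  shows "(\<lambda>x. \<Sum>\<^sub>\<infinity>Q\<in>D'. indicator Q x * c Q) \<in> borel_measurable lebesgue"
  using assms dyadic_lattice_measurable[OF D] countable_subset[OF assms countable_dyadic_lattice[OF D]]
  by (intro borel_measurable_infsum_ennreal borel_measurable_times borel_measurable_indicator) auto

lemma lattice_SUP_measurable[measurable]:
  fixes c :: "(real ^ 'n) set \<Rightarrow> ennreal"
  shows "(\<lambda>x. SUP Q\<in>D. indicator Q x * c Q) \<in> borel_measurable lebesgue"
  using dyadic_lattice_measurable[OF D] countable_dyadic_lattice[OF D]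
  by (intro borel_measurable_SUP borel_measurable_times borel_measurable_indicator) auto

lemma potential_measurable[measurable]: "potential D \<alpha> u \<in> borel_measurable lebesgue"
  unfolding potential_def[abs_def] by (rule lattice_sum_measurable) simp

lemma maximal_measurable[measurable]: "maximal D f \<in> borel_measurable lebesgue"
  unfolding maximal_def[abs_def] by (rule lattice_SUP_measurable)

lemma frac_maximal_measurable[measurable]: "frac_maximal D \<alpha> f \<in> borel_measurable lebesgue"
  unfolding frac_maximal_def[abs_def] by (rule lattice_SUP_measurable)

lemma frac_pos_measurable[measurable]: "frac_pos D \<alpha> f \<in> borel_measurable lebesgue"
  unfolding frac_pos_def[abs_def] by (rule lattice_sum_measurable) simp

lemma frac_neg_measurable[measurable]: "frac_neg D \<alpha> f \<in> borel_measurable lebesgue"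
  unfolding frac_neg_def[abs_def] by (rule lattice_sum_measurable) simp

lemma frac_integral_measurable[measurable]:
  "(\<lambda>x. e2ennreal \<bar>frac_integral D \<alpha> f x\<bar>) \<in> borel_measurable lebesgue"
  unfolding frac_integral_def by measurable

text \<open>
  The Bochner integral of a function that is not integrable is \<open>0\<close>, so the bound holds for every
  \<open>f\<close>.
\<close>

lemma abs_frac_coeff_le:
  "ennreal \<bar>frac_coeff \<alpha> f Q\<bar> \<le>
     (\<integral>\<^sup>+y\<in>Q. ennreal \<bar>f y\<bar> \<partial>lebesgue) / ennreal (vol Q powr (1 - mean \<alpha> Q))" if Q: "Q \<in> D"
proof -
  have v: "0 < vol Q powr (1 - mean \<alpha> Q)" using dyadic_lattice_vol_pos[OF D Q] by simp
  have "ennreal \<bar>LINT y:Q|lebesgue. f y\<bar> \<le> (\<integral>\<^sup>+y. ennreal \<bar>indicator Q y * f y\<bar> \<partial>lebesgue)"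
  proof (cases "integrable lebesgue (\<lambda>y. indicator Q y * f y)")
    case True
    then show ?thesis
      using integral_norm_bound_ennreal[OF True] by (simp add: set_lebesgue_integral_def)
  next
    case False
    then show ?thesis by (simp add: set_lebesgue_integral_def not_integrable_integral_eq)
  qed
  also have "\<dots> = (\<integral>\<^sup>+y\<in>Q. ennreal \<bar>f y\<bar> \<partial>lebesgue)"
    by (intro nn_integral_cong) (auto simp: indicator_def)
  finally have "ennreal \<bar>LINT y:Q|lebesgue. f y\<bar> / ennreal (vol Q powr (1 - mean \<alpha> Q)) \<le>
      (\<integral>\<^sup>+y\<in>Q. ennreal \<bar>f y\<bar> \<partial>lebesgue) / ennreal (vol Q powr (1 - mean \<alpha> Q))"
    by (rule divide_right_mono_ennreal)
  then show ?thesis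
    using v by (simp add: frac_coeff_def divide_ennreal)
qed

lemma frac_pos_le: "frac_pos D \<alpha> f x \<le> potential D \<alpha> (\<lambda>x. ennreal \<bar>f x\<bar>) x"
  and frac_neg_le: "frac_neg D \<alpha> f x \<le> potential D \<alpha> (\<lambda>x. ennreal \<bar>f x\<bar>) x"
  unfolding frac_pos_def frac_neg_def potential_def
  by (auto intro!: infsum_ennreal_mono mult_left_mono order_trans[OF _ abs_frac_coeff_le] ennreal_leI)

text \<open>
  If both parts of the series are infinite, then so is the potential; otherwise the absolute value
  of a difference of nonnegative numbers is at most their maximum.
\<close>

lemma abs_frac_integral_le:
  "e2ennreal \<bar>frac_integral D \<alpha> f x\<bar> \<le> potential D \<alpha> (\<lambda>x. ennreal \<bar>f x\<bar>) x"
proof -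
  have "e2ennreal \<bar>enn2ereal a - enn2ereal b\<bar> \<le> max a b" for a b :: ennreal
  proof (cases "a = top \<or> b = top")
    case False
    then obtain r s where "a = ennreal r" "b = ennreal s" "0 \<le> r" "0 \<le> s"
      by (cases a; cases b) auto
    then show ?thesis by (auto simp: max_def enn2ereal_ennreal ennreal_leI)
  qed auto
  then show ?thesis
    unfolding frac_integral_def by (rule order_trans) (simp add: frac_pos_le frac_neg_le)
qed

lemma frac_integral_nonneg:
  assumes [measurable]: "f \<in> borel_measurable lebesgue" and "\<And>x. 0 \<le> f x"
    and fin: "\<And>Q. Q \<in> D \<Longrightarrow> (\<integral>\<^sup>+y\<in>Q. ennreal (f y) \<partial>lebesgue) < top"
  shows "e2ennreal \<bar>frac_integral D \<alpha> f x\<bar> = potential D \<alpha> (\<lambda>x. ennreal (f x)) x"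
proof -
  have coeff: "ennreal (frac_coeff \<alpha> f Q) =
      (\<integral>\<^sup>+y\<in>Q. ennreal (f y) \<partial>lebesgue) / ennreal (vol Q powr (1 - mean \<alpha> Q))"
    and coeff0: "0 \<le> frac_coeff \<alpha> f Q" if Q: "Q \<in> D" for Q
  proof -
    have [measurable]: "Q \<in> sets lebesgue" by (rule dyadic_lattice_measurable[OF D Q])
    have v: "0 < vol Q powr (1 - mean \<alpha> Q)" using dyadic_lattice_vol_pos[OF D Q] by simp
    have eq: "(\<integral>\<^sup>+y\<in>Q. ennreal (f y) \<partial>lebesgue) = (\<integral>\<^sup>+y. ennreal (indicator Q y * f y) \<partial>lebesgue)"
      by (intro nn_integral_cong) (auto simp: indicator_def)
    have "integrable lebesgue (\<lambda>y. indicator Q y * f y)"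
      using fin[OF Q] assms(2) by (intro integrableI_nonneg) (auto simp: eq)
    then have i: "(\<integral>\<^sup>+y\<in>Q. ennreal (f y) \<partial>lebesgue) = ennreal (LINT y:Q|lebesgue. f y)"
      using assms(2) unfolding eq by (subst nn_integral_eq_integral) (auto simp: set_lebesgue_integral_def)
    have i0: "0 \<le> (LINT y:Q|lebesgue. f y)"
      using assms(2) by (simp add: set_lebesgue_integral_def)
    show "0 \<le> frac_coeff \<alpha> f Q" using i0 by (simp add: frac_coeff_def)
    show "ennreal (frac_coeff \<alpha> f Q) =
      (\<integral>\<^sup>+y\<in>Q. ennreal (f y) \<partial>lebesgue) / ennreal (vol Q powr (1 - mean \<alpha> Q))"
      using i0 v unfolding i by (simp add: frac_coeff_def divide_ennreal)
  qed
  have "frac_pos D \<alpha> f x = potential D \<alpha> (\<lambda>x. ennreal (f x)) x"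
    unfolding frac_pos_def potential_def by (intro infsum_cong) (simp add: coeff)
  moreover have "frac_neg D \<alpha> f x = 0"
    unfolding frac_neg_def by (intro infsum_0) (auto simp: coeff0 ennreal_neg)
  ultimately show ?thesis
    by (simp add: frac_integral_def zero_ennreal.rep_eq)
qed

lemma frac_maximal_le_potential:
  "frac_maximal D \<alpha> f x \<le> potential D \<alpha> (\<lambda>x. ennreal \<bar>f x\<bar>) x"
  unfolding frac_maximal_def potential_def
proof (rule SUP_least)
  fix Q assume "Q \<in> D"
  then show "indicator Q x * ((\<integral>\<^sup>+y\<in>Q. ennreal \<bar>f y\<bar> \<partial>lebesgue) / ennreal (vol Q powr (1 - mean \<alpha> Q))) \<le>
      (\<Sum>\<^sub>\<infinity>Q\<in>D. indicator Q x * ((\<integral>\<^sup>+y\<in>Q. ennreal \<bar>f y\<bar> \<partial>lebesgue) / ennreal (vol Q powr (1 - mean \<alpha> Q))))"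
    using sum_le_infsum_ennreal[of "{Q}" D] by force
qed

lemma packing_le:
  assumes C: "packing_const D \<alpha> = ennreal C" and Q: "Q \<in> D"
  shows "(\<Sum>\<^sub>\<infinity>P\<in>{P\<in>D. P \<subseteq> Q}. ennreal (vol P powr (1 + mean \<alpha> P))) \<le> ennreal C * ennreal (vol Q powr (1 + mean \<alpha> Q))"
proof -
  let ?S = "\<Sum>\<^sub>\<infinity>P\<in>{P\<in>D. P \<subseteq> Q}. ennreal (vol P powr (1 + mean \<alpha> P))"
  let ?v = "ennreal (vol Q powr (1 + mean \<alpha> Q))"
  have v: "?v \<noteq> 0" "?v \<noteq> top" using dyadic_lattice_vol_pos[OF D Q] by auto
  have "?S / ?v \<le> ennreal C"
    using Q unfolding C[symmetric] packing_const_def by (intro SUP_upper2[of Q]) auto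
  then have "?S / ?v * ?v \<le> ennreal C * ?v" by (rule mult_right_mono) simp
  also have "?S / ?v * ?v = ?S" using v by (simp add: ennreal_divide_times less_top[symmetric])
  finally show ?thesis .
qed

text \<open>
  Expanding the potential turns the pairing into the sum of \<open>\<lambda>\<^sub>Q \<langle>f\<rangle>\<^sub>Q \<langle>g\<rangle>\<^sub>Q\<close> with
  \<open>\<lambda>\<^sub>Q = |Q| powr (1 + \<langle>\<alpha>\<rangle>\<^sub>Q)\<close>, to whose finite partial sums the stopping argument applies. On \<open>Q\<close>,
  the two maximal functions dominate \<open>|Q| powr \<langle>\<alpha>\<rangle>\<^sub>Q\<close> times \<open>\<langle>f\<rangle>\<^sub>Q\<close>, and \<open>\<langle>g\<rangle>\<^sub>Q\<close>.
\<close>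

lemma potential_pairing_le:
  fixes f g :: "real ^ 'n \<Rightarrow> real"
  assumes C: "packing_const D \<alpha> = ennreal C"
    and [measurable]: "f \<in> borel_measurable lebesgue" "g \<in> borel_measurable lebesgue"
    and fin: "\<And>Q. Q \<in> D \<Longrightarrow> (\<integral>\<^sup>+y\<in>Q. ennreal \<bar>f y\<bar> \<partial>lebesgue) < top"
      "\<And>Q. Q \<in> D \<Longrightarrow> (\<integral>\<^sup>+y\<in>Q. ennreal \<bar>g y\<bar> \<partial>lebesgue) < top"
  shows "(\<integral>\<^sup>+x. potential D \<alpha> (\<lambda>x. ennreal \<bar>f x\<bar>) x * ennreal \<bar>g x\<bar> \<partial>lebesgue) \<le>
    32 * ennreal C * (\<integral>\<^sup>+x. frac_maximal D \<alpha> f x * maximal D g x \<partial>lebesgue)"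
proof -
  let ?f = "\<lambda>x. ennreal \<bar>f x\<bar>" and ?g = "\<lambda>x. ennreal \<bar>g x\<bar>"
  let ?af = "average lebesgue ?f" and ?ag = "average lebesgue ?g"
  let ?lam = "\<lambda>Q. ennreal (vol Q powr (1 + mean \<alpha> Q))"
  let ?c = "\<lambda>Q. (\<integral>\<^sup>+y\<in>Q. ?f y \<partial>lebesgue) / ennreal (vol Q powr (1 - mean \<alpha> Q))"
  have vol0: "0 < vol Q" and em: "emeasure lebesgue Q = ennreal (vol Q)"
    and Qm: "Q \<in> sets lebesgue" if "Q \<in> D" for Q
    using that dyadic_lattice_vol_pos[OF D] dyadic_lattice_emeasure[OF D] dyadic_lattice_measurable[OF D] by auto
  have c_eq: "?c Q = ennreal (vol Q powr mean \<alpha> Q) * ?af Q" if Q: "Q \<in> D" for Q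
  proof -
    obtain r where r: "(\<integral>\<^sup>+y\<in>Q. ?f y \<partial>lebesgue) = ennreal r" "0 \<le> r"
      using fin(1)[OF Q] by (auto simp: less_top_ennreal)
    show ?thesis
      using vol0[OF Q] r(2)
      by (simp add: average_def em[OF Q] r(1) divide_ennreal powr_diff flip: ennreal_mult')
  qed
  have cube_term: "(\<integral>\<^sup>+x. indicator Q x * ?c Q * ?g x \<partial>lebesgue) = ?lam Q * ?af Q * ?ag Q" if Q: "Q \<in> D" for Q
  proof -
    note [measurable] = Qm[OF Q]
    have "(\<integral>\<^sup>+x. indicator Q x * ?c Q * ?g x \<partial>lebesgue) = (\<integral>\<^sup>+x. ?c Q * (?g x * indicator Q x) \<partial>lebesgue)"
      by (intro nn_integral_cong) (simp add: mult_ac)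
    also have "\<dots> = ?c Q * (\<integral>\<^sup>+x\<in>Q. ?g x \<partial>lebesgue)"
      by (rule nn_integral_cmult) measurable
    also have "(\<integral>\<^sup>+x\<in>Q. ?g x \<partial>lebesgue) = ?ag Q * ennreal (vol Q)"
      using vol0[OF Q] em[OF Q] nn_integral_eq_average[of lebesgue Q ?g] by simp
    also have "?c Q * (?ag Q * ennreal (vol Q)) = (ennreal (vol Q) * ennreal (vol Q powr mean \<alpha> Q)) * ?af Q * ?ag Q"
      unfolding c_eq[OF Q] by (simp add: mult_ac)
    also have "ennreal (vol Q) * ennreal (vol Q powr mean \<alpha> Q) = ?lam Q"
      using vol0[OF Q] by (simp add: powr_add flip: ennreal_mult')
    finally show ?thesis .
  qed
  have "(\<integral>\<^sup>+x. potential D \<alpha> ?f x * ?g x \<partial>lebesgue) =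
      (\<integral>\<^sup>+x. (\<Sum>\<^sub>\<infinity>Q\<in>D. indicator Q x * ?c Q * ?g x) \<partial>lebesgue)"
    unfolding potential_def
    by (subst mult.commute, subst infsum_ennreal_cmult) (simp add: mult_ac)
  also have "\<dots> = (\<Sum>\<^sub>\<infinity>Q\<in>D. \<integral>\<^sup>+x. indicator Q x * ?c Q * ?g x \<partial>lebesgue)"
    using Qm by (intro nn_integral_infsum countable_dyadic_lattice D borel_measurable_times borel_measurable_indicator) auto
  also have "\<dots> = (\<Sum>\<^sub>\<infinity>Q\<in>D. ?lam Q * ?af Q * ?ag Q)"
    by (intro infsum_cong cube_term)
  also have "\<dots> \<le> 32 * ennreal C * (\<integral>\<^sup>+x. frac_maximal D \<alpha> f x * maximal D g x \<partial>lebesgue)"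
  proof (rule infsum_ennreal_le, rule stopping_sum_le_total)
    fix F assume F: "finite F" "F \<subseteq> D"
    show "laminar F" using dyadic_lattice_laminar[OF D] F(2) by (rule laminar_mono)
    show "F \<subseteq> sets lebesgue" using F Qm by auto
    fix Q assume "Q \<in> F"
    then have Q: "Q \<in> D" using F by auto
    show "0 < emeasure lebesgue Q \<and> emeasure lebesgue Q < top"
      using vol0[OF Q] em[OF Q] by simp
    have "(\<Sum>P\<in>{P\<in>F. P \<subseteq> Q}. ?lam P) \<le> (\<Sum>\<^sub>\<infinity>P\<in>{P\<in>D. P \<subseteq> Q}. ?lam P)"
      using F by (intro sum_le_infsum_ennreal) auto
    also have "\<dots> \<le> ennreal C * ?lam Q" by (rule packing_le[OF C Q])
    finally show "(\<Sum>P\<in>{P\<in>F. P \<subseteq> Q}. ?lam P) \<le> ennreal C * ?lam Q" .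
    fix x assume x: "x \<in> Q"
    have "ennreal (vol Q powr mean \<alpha> Q) * ?af Q \<le> frac_maximal D \<alpha> f x"
      unfolding frac_maximal_def using x Q c_eq[OF Q] by (intro SUP_upper2[of Q]) auto
    moreover have "?ag Q \<le> maximal D g x"
      unfolding maximal_def using x Q em[OF Q] by (intro SUP_upper2[of Q]) (auto simp: average_def)
    ultimately have "(ennreal (vol Q powr mean \<alpha> Q) * ?af Q) * ?ag Q \<le> frac_maximal D \<alpha> f x * maximal D g x"
      by (rule mult_mono) auto
    then have "ennreal (vol Q) * ((ennreal (vol Q powr mean \<alpha> Q) * ?af Q) * ?ag Q) \<le>
        emeasure lebesgue Q * (frac_maximal D \<alpha> f x * maximal D g x)"
      unfolding em[OF Q] by (rule mult_left_mono) simp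
    also have "ennreal (vol Q) * ((ennreal (vol Q powr mean \<alpha> Q) * ?af Q) * ?ag Q) = ?lam Q * ?af Q * ?ag Q"
      using vol0[OF Q] by (simp add: powr_add ennreal_mult mult.assoc)
    finally show "?lam Q * ?af Q * ?ag Q \<le> emeasure lebesgue Q * (frac_maximal D \<alpha> f x * maximal D g x)" .
  qed (use fin in auto)
  finally show ?thesis .
qed

end

lemma lnorm_finite_AE:
  fixes p h :: "real ^ 'n \<Rightarrow> ennreal"
  assumes [measurable]: "p \<in> borel_measurable lebesgue" "h \<in> borel_measurable lebesgue"
    and p: "AE x in lebesgue. p x < top" and h: "lnorm p h < top"
  shows "AE x in lebesgue. h x < top"
proof -
  obtain r where r: "lnorm p h = ennreal r" "0 \<le> r" using h by (auto simp: less_top_ennreal)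
  then have "(\<integral>\<^sup>+x. epowr (h x / ennreal (r + 1)) (p x) \<partial>lebesgue) \<le> 1"
    using p by (intro modular_le_one) (auto simp: ennreal_less_iff)
  then have "(\<integral>\<^sup>+x. epowr (h x / ennreal (r + 1)) (p x) \<partial>lebesgue) \<noteq> \<infinity>" by (auto simp: top_unique)
  then have "AE x in lebesgue. epowr (h x / ennreal (r + 1)) (p x) \<noteq> \<infinity>"
    by (intro nn_integral_PInf_AE) measurable
  then show ?thesis
    by (rule eventually_mono) (auto simp: epowr_def less_top[symmetric] ennreal_top_divide)
qed

text \<open>
  Duality bounds the norm of the potential of \<open>\<bar>f\<bar>\<close>, with the constant \<open>64 = 32 * 2\<close> from the stopping
  argument and Hoelder's inequality. Its finiteness almost everywhere then shows that the
  fractional integral of \<open>f\<close> is well defined.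
\<close>

lemma frac_integral_bounded_if_packing:
  fixes p q \<alpha> :: "real ^ 'n \<Rightarrow> ennreal" and D :: "(real ^ 'n) set set"
  assumes D: "dyadic_lattice D"
    and p[measurable]: "p \<in> borel_measurable lebesgue" and q[measurable]: "q \<in> borel_measurable lebesgue"
    and pq: "AE x in lebesgue. 1 < p x \<and> p x < top" "AE x in lebesgue. 1 < q x \<and> q x < top"
    and M: "bounded_op (maximal D) (conj_exponent q) (conj_exponent q)"
    and C: "packing_const D \<alpha> < top"
    and F: "bounded_op (frac_maximal D \<alpha>) p q"
  shows "frac_integral_bounded D \<alpha> p q"
proof -
  let ?q' = "conj_exponent q"
  note [measurable] = potential_measurable[OF D] maximal_measurable[OF D] frac_maximal_measurable[OF D]
    frac_pos_measurable[OF D] frac_neg_measurable[OF D] frac_integral_measurable[OF D]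
  have conj: "conjugate_pair q ?q'" by (rule conjugate_pair_conj_exponent[OF q pq(2)])
  then have [measurable]: "?q' \<in> borel_measurable lebesgue" and q': "AE x in lebesgue. 1 < ?q' x \<and> ?q' x < top"
    by (auto simp: conjugate_pair_def)
  have q_fin: "AE x in lebesgue. q x < top" using pq(2) by auto
  obtain c where c: "packing_const D \<alpha> = ennreal c" "0 \<le> c" using C by (auto simp: less_top_ennreal)
  obtain a where a: "\<And>f. f \<in> Lspace p \<Longrightarrow>
      lnorm q (frac_maximal D \<alpha> f) \<le> ennreal a * lnorm p (\<lambda>x. ennreal \<bar>f x\<bar>)"
    using F unfolding bounded_op_def by auto
  obtain b where b: "\<And>g. g \<in> Lspace ?q' \<Longrightarrow>
      lnorm ?q' (maximal D g) \<le> ennreal b * lnorm ?q' (\<lambda>x. ennreal \<bar>g x\<bar>)"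
    using M unfolding bounded_op_def by auto
  have loc: "(\<integral>\<^sup>+y\<in>Q. ennreal \<bar>f y\<bar> \<partial>lebesgue) < top"
    if "Q \<in> D" "f \<in> Lspace r" "r \<in> borel_measurable lebesgue" "AE x in lebesgue. 1 < r x \<and> r x < top" for Q f r
    using that dyadic_lattice_measurable[OF D] dyadic_lattice_emeasure[OF D]
    by (intro Lspace_integrable_on[of f r Q]) auto
  \<comment> \<open>The constant of a bounded operator may be negative, in which case it acts as \<open>0\<close>.\<close>
  define K where "K = 64 * c * max 0 a * max 0 b"
  have main: "lnorm q (potential D \<alpha> (\<lambda>x. ennreal \<bar>f x\<bar>)) \<le> ennreal K * lnorm p (\<lambda>x. ennreal \<bar>f x\<bar>)"
    if f: "f \<in> Lspace p" for f
  proof (rule lnorm_le_dual[OF conj])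
    have [measurable]: "f \<in> borel_measurable lebesgue" using f by (simp add: Lspace_def)
    show "potential D \<alpha> (\<lambda>x. ennreal \<bar>f x\<bar>) \<in> borel_measurable lebesgue" by measurable
    fix g :: "real ^ 'n \<Rightarrow> real"
    assume g[measurable]: "g \<in> borel_measurable lebesgue" and g0: "\<And>x. 0 \<le> g x"
      and g1: "lnorm ?q' (\<lambda>x. ennreal (g x)) \<le> 1"
    have abs_g: "\<bar>g x\<bar> = g x" for x using g0 by simp
    have gL: "g \<in> Lspace ?q'"
      using g1 by (auto simp: Lspace_def abs_g intro: le_less_trans)
    have f_norm: "lnorm p (\<lambda>x. ennreal \<bar>f x\<bar>) < top" using f by (simp add: Lspace_def)
    have Mf: "lnorm q (frac_maximal D \<alpha> f) \<le> ennreal (max 0 a) * lnorm p (\<lambda>x. ennreal \<bar>f x\<bar>)"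
      using a[OF f] by (simp add: ennreal_max_0)
    have "lnorm ?q' (maximal D g) \<le> ennreal (max 0 b) * lnorm ?q' (\<lambda>x. ennreal (g x))"
      using b[OF gL] by (simp add: ennreal_max_0 abs_g)
    also have "\<dots> \<le> ennreal (max 0 b) * 1" by (intro mult_left_mono g1) simp
    finally have Mg: "lnorm ?q' (maximal D g) \<le> ennreal (max 0 b)" by simp
    have "(\<integral>\<^sup>+x. potential D \<alpha> (\<lambda>x. ennreal \<bar>f x\<bar>) x * ennreal \<bar>g x\<bar> \<partial>lebesgue) \<le>
        32 * ennreal c * (\<integral>\<^sup>+x. frac_maximal D \<alpha> f x * maximal D g x \<partial>lebesgue)"
      using c f gL loc p q' pq(1) by (intro potential_pairing_le D) auto
    also have "\<dots> \<le> 32 * ennreal c * (2 * (lnorm q (frac_maximal D \<alpha> f) * lnorm ?q' (maximal D g)))"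
      using Mf Mg f_norm
      by (intro mult_left_mono Hoelder_lnorm conj)
        (auto intro: le_less_trans simp: ennreal_mult_less_top)
    also have "\<dots> \<le> 32 * ennreal c * (2 * ((ennreal (max 0 a) * lnorm p (\<lambda>x. ennreal \<bar>f x\<bar>)) * ennreal (max 0 b)))"
      by (intro mult_left_mono mult_mono Mf Mg) auto
    also have "\<dots> = ennreal K * lnorm p (\<lambda>x. ennreal \<bar>f x\<bar>)"
    proof -
      have "ennreal K = 32 * ennreal c * 2 * ennreal (max 0 a) * ennreal (max 0 b)"
        using c by (simp add: K_def flip: ennreal_numeral ennreal_mult')
      then show ?thesis by (simp only: mult_ac)
    qed
    finally show "(\<integral>\<^sup>+x. potential D \<alpha> (\<lambda>x. ennreal \<bar>f x\<bar>) x * ennreal (g x) \<partial>lebesgue) \<le>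
        ennreal K * lnorm p (\<lambda>x. ennreal \<bar>f x\<bar>)"
      by (simp add: abs_g)
  qed
  have "AE x in lebesgue. frac_integral_defined D \<alpha> f x" if f: "f \<in> Lspace p" for f
  proof -
    have "lnorm q (potential D \<alpha> (\<lambda>x. ennreal \<bar>f x\<bar>)) < top"
      using f by (intro le_less_trans[OF main[OF f]]) (simp add: Lspace_def ennreal_mult_less_top)
    then have "AE x in lebesgue. potential D \<alpha> (\<lambda>x. ennreal \<bar>f x\<bar>) x < top"
      by (rule lnorm_finite_AE[OF q potential_measurable[OF D] q_fin])
    then show ?thesis
      by (rule eventually_mono)
        (simp add: frac_integral_defined_def le_less_trans[OF frac_pos_le[OF D]])
  qed
  moreover have "lnorm q (\<lambda>x. e2ennreal \<bar>frac_integral D \<alpha> f x\<bar>) \<le> ennreal K * lnorm p (\<lambda>x. ennreal \<bar>f x\<bar>)"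
    if f: "f \<in> Lspace p" for f
    by (rule order_trans[OF lnorm_mono main[OF f]])
      (simp_all add: abs_frac_integral_le[OF D] q_fin frac_integral_measurable[OF D] potential_measurable[OF D])
  ultimately show ?thesis
    unfolding frac_integral_bounded_def bounded_op_def by auto
qed

section \<open>Norms of indicators of cubes\<close>

text \<open>
  The bound by \<open>1\<close> makes all integrals finite, so that nothing is lost in \<^const>\<open>enn2real\<close>.
\<close>

lemma mean_add:
  fixes \<beta> \<gamma> \<delta> :: "real ^ 'n \<Rightarrow> ennreal"
  assumes [measurable]: "\<beta> \<in> borel_measurable lebesgue" "\<gamma> \<in> borel_measurable lebesgue"
    and Q[measurable]: "Q \<in> sets lebesgue" and v: "emeasure lebesgue Q = ennreal v" "0 < v"
    and add: "AE x in lebesgue. \<beta> x + \<gamma> x = \<delta> x \<and> \<delta> x \<le> 1"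
  shows "mean \<delta> Q = mean \<beta> Q + mean \<gamma> Q"
proof -
  have fin: "(\<integral>\<^sup>+x\<in>Q. h x \<partial>lebesgue) < top" if "AE x in lebesgue. h x \<le> 1" for h :: "real ^ 'n \<Rightarrow> ennreal"
  proof -
    have "(\<integral>\<^sup>+x\<in>Q. h x \<partial>lebesgue) \<le> (\<integral>\<^sup>+x. indicator Q x \<partial>lebesgue)"
      using that by (intro nn_integral_mono_AE) (auto elim!: eventually_mono simp: indicator_def)
    then show ?thesis by (rule le_less_trans) (simp add: v)
  qed
  have 1: "(\<integral>\<^sup>+x\<in>Q. \<beta> x \<partial>lebesgue) < top" "(\<integral>\<^sup>+x\<in>Q. \<gamma> x \<partial>lebesgue) < top"
  proof (safe intro!: fin)
    show "AE x in lebesgue. \<beta> x \<le> 1"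
      using add by (rule eventually_mono) (metis le_add1 order_trans le_iff_add)
    show "AE x in lebesgue. \<gamma> x \<le> 1"
      using add by (rule eventually_mono) (metis add.commute order_trans le_iff_add)
  qed
  have "(\<integral>\<^sup>+x\<in>Q. \<delta> x \<partial>lebesgue) = (\<integral>\<^sup>+x. \<beta> x * indicator Q x + \<gamma> x * indicator Q x \<partial>lebesgue)"
    using add by (intro nn_integral_cong_AE) (auto elim!: eventually_mono simp flip: distrib_right)
  also have "\<dots> = (\<integral>\<^sup>+x\<in>Q. \<beta> x \<partial>lebesgue) + (\<integral>\<^sup>+x\<in>Q. \<gamma> x \<partial>lebesgue)"
    by (rule nn_integral_add) auto
  finally show ?thesis
    using 1 v by (simp add: mean_def add_divide_distrib_ennreal enn2real_plus ennreal_divide_eq_top_iff less_top[symmetric])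
qed

text \<open>
  The maximum \<open>l\<close> of \<open>1\<close> and the measure of \<open>Q\<close> is admissible in the infimum: \<open>(1/l) powr r \<le> 1/l\<close>
  for \<open>r \<ge> 1\<close>, which integrates to at most \<open>1\<close>.
\<close>

lemma lnorm_indicator_finite:
  fixes p :: "real ^ 'n \<Rightarrow> ennreal"
  assumes [measurable]: "p \<in> borel_measurable lebesgue" "Q \<in> sets lebesgue"
    and p: "AE x in lebesgue. 1 < p x \<and> p x < top" and fin: "emeasure lebesgue Q < top"
  shows "lnorm p (indicator Q) < top"
proof -
  obtain v where v: "emeasure lebesgue Q = ennreal v" "0 \<le> v" using fin by (auto simp: less_top_ennreal)
  define l where "l = max 1 v"
  have l: "1 \<le> l" "v \<le> l" by (auto simp: l_def)
  have "modular p (\<lambda>x. indicator Q x / ennreal l) = (\<integral>\<^sup>+x. epowr (indicator Q x / ennreal l) (p x) \<partial>lebesgue)"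
    using p by (intro modular_eq) auto
  also have "\<dots> \<le> (\<integral>\<^sup>+x. ennreal (1 / l) * indicator Q x \<partial>lebesgue)"
  proof (rule nn_integral_mono_AE, rule eventually_mono[OF p])
    fix x assume "1 < p x \<and> p x < top"
    then have "1 \<le> enn2real (p x)" by (cases "p x") (auto simp: one_less_ennreal)
    then have "(1 / l) powr enn2real (p x) \<le> (1 / l) powr 1"
      using l by (intro powr_mono') auto
    then show "epowr (indicator Q x / ennreal l) (p x) \<le> ennreal (1 / l) * indicator Q x"
      using l divide_ennreal[of 1 l]
      by (cases "x \<in> Q") (auto simp: epowr_ennreal epowr_def[of 0] intro!: ennreal_leI)
  qed
  also have "\<dots> = ennreal (v / l)"
    using v l by (simp add: nn_integral_cmult_indicator flip: ennreal_mult')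
  also have "\<dots> \<le> 1" using l v by (simp add: ennreal_le_1)
  finally have "lnorm p (indicator Q) \<le> ennreal l" using l by (intro lnorm_le) auto
  then show ?thesis by (rule le_less_trans) simp
qed

text \<open>
  With \<open>t = 1/p\<close>, the function \<open>\<phi> = v powr (-t)\<close> on \<open>Q\<close> has modular \<open>1\<close> for the exponent \<open>p\<close>, so
  Hoelder's inequality bounds its integral by twice the norm of the indicator for \<open>p'\<close>. By Jensen's
  inequality for the exponential function the integral is at least \<open>v\<close> times \<open>v powr (-\<langle>t\<rangle>\<^sub>Q)\<close>.
\<close>

lemma powr_mean_le_lnorm:
  fixes p p' :: "real ^ 'n \<Rightarrow> ennreal"
  assumes conj: "conjugate_pair p p'" and Q[measurable]: "Q \<in> sets lebesgue"
    and v: "emeasure lebesgue Q = ennreal v" "0 < v"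
  shows "ennreal (v powr (1 - mean (\<lambda>x. 1 / p x) Q)) \<le> 2 * lnorm p' (indicator Q)"
proof -
  have [measurable]: "p \<in> borel_measurable lebesgue" "p' \<in> borel_measurable lebesgue"
    and ae: "AE x in lebesgue. 1 < p x \<and> p x < top" and ae': "AE x in lebesgue. 1 < p' x \<and> p' x < top"
    using conj by (auto simp: conjugate_pair_def)
  define t where "t x = 1 / enn2real (p x)" for x
  have [measurable]: "t \<in> borel_measurable lebesgue" unfolding t_def by measurable
  have aet: "AE x in lebesgue. 1 < p x \<and> p x < top \<and> 0 \<le> t x \<and> t x \<le> 1 \<and> 1 / p x = ennreal (t x) \<and> t x * enn2real (p x) = 1"
  proof (rule eventually_mono[OF ae])
    fix x assume "1 < p x \<and> p x < top"
    then obtain r where r: "p x = ennreal r" "1 < r" by (cases "p x") (auto simp: one_less_ennreal)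
    then show "1 < p x \<and> p x < top \<and> 0 \<le> t x \<and> t x \<le> 1 \<and> 1 / p x = ennreal (t x) \<and> t x * enn2real (p x) = 1"
      using divide_ennreal[of 1 r] by (auto simp: t_def one_less_ennreal)
  qed
  have tae: "AE x in lebesgue. 0 \<le> t x \<and> t x \<le> 1" using aet by (rule eventually_mono) auto
  define c where "c = ln v"
  define u where "u = mean (\<lambda>x. 1 / p x) Q"
  define \<phi> where "\<phi> x = indicator Q x * exp (- c * t x)" for x
  have [measurable]: "\<phi> \<in> borel_measurable lebesgue" unfolding \<phi>_def by measurable
  have int_t: "integrable lebesgue (\<lambda>x. indicator Q x * t x)"
  proof (rule integrableI_bounded_set[of Q _ _ 1])
    show "AE x in lebesgue. x \<in> Q \<longrightarrow> norm (indicator Q x * t x) \<le> 1"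
      using tae by (rule eventually_mono) simp
  qed (use v in auto)
  have int_Q: "integrable lebesgue (\<lambda>x. indicator Q x :: real)"
    using v by (intro integrableI_bounded_set[of Q _ _ 1]) (auto simp: indicator_def)
  have int_\<phi>: "integrable lebesgue \<phi>"
  proof (rule integrableI_bounded_set[of Q _ _ "exp \<bar>c\<bar>"])
    have "- c * s \<le> \<bar>c\<bar>" if "0 \<le> s" "s \<le> 1" for s
      using that mult_left_le[of s "\<bar>c\<bar>"] by (smt (verit) mult_minus_left mult_right_mono)
    then show "AE x in lebesgue. x \<in> Q \<longrightarrow> norm (\<phi> x) \<le> exp \<bar>c\<bar>"
      using tae by (elim eventually_mono) (simp add: \<phi>_def)
  qed (use v in \<open>auto simp: \<phi>_def\<close>)
  have LQ: "(LINT x|lebesgue. indicator Q x) = v"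
    using v by (simp add: measure_def)
  have Lt: "(LINT x|lebesgue. indicator Q x * t x) = u * v"
  proof -
    have "(\<integral>\<^sup>+x\<in>Q. 1 / p x \<partial>lebesgue) = (\<integral>\<^sup>+x. ennreal (indicator Q x * t x) \<partial>lebesgue)"
      by (intro nn_integral_cong_AE eventually_mono[OF aet]) (auto simp: indicator_def)
    also have "\<dots> = ennreal (LINT x|lebesgue. indicator Q x * t x)"
      by (intro nn_integral_eq_integral int_t eventually_mono[OF tae]) simp
    finally have *: "(\<integral>\<^sup>+x\<in>Q. 1 / p x \<partial>lebesgue) = ennreal (LINT x|lebesgue. indicator Q x * t x)" .
    have "0 \<le> (LINT x|lebesgue. indicator Q x * t x)"
      by (intro integral_nonneg_AE eventually_mono[OF tae]) simp
    then show ?thesis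
      using v unfolding u_def mean_def * by (simp add: divide_ennreal)
  qed
  \<comment> \<open>Jensen's inequality, by integrating the tangent of the exponential function at the mean.\<close>
  have "v * exp (- c * u) = exp (- c * u) * ((1 + c * u) * v - c * (u * v))"
    by (simp add: algebra_simps)
  also have "\<dots> = (LINT x|lebesgue. exp (- c * u) * ((1 + c * u) * indicator Q x - c * (indicator Q x * t x)))"
    using int_t int_Q LQ by (simp add: Lt)
  also have "\<dots> \<le> (LINT x|lebesgue. \<phi> x)"
  proof (rule integral_mono)
    fix x
    have "exp (- c * u) * (1 + (- c * t x + c * u)) \<le> exp (- c * u) * exp (- c * t x + c * u)"
      by (intro mult_left_mono exp_ge_add_one_self) auto
    also have "\<dots> = exp (- c * t x)" by (simp flip: exp_add)
    finally show "exp (- c * u) * ((1 + c * u) * indicator Q x - c * (indicator Q x * t x)) \<le> \<phi> x"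
      by (auto simp: \<phi>_def indicator_def algebra_simps)
  qed (use int_t int_Q int_\<phi> in auto)
  also have "v * exp (- c * u) = v powr (1 - u)"
    using v by (simp add: c_def powr_def algebra_simps exp_add exp_diff exp_minus field_simps)
  finally have "ennreal (v powr (1 - u)) \<le> ennreal (LINT x|lebesgue. \<phi> x)" by (rule ennreal_leI)
  also have "\<dots> = (\<integral>\<^sup>+x. ennreal (\<phi> x) \<partial>lebesgue)"
    by (intro nn_integral_eq_integral[symmetric] int_\<phi>) (auto simp: \<phi>_def)
  also have "\<dots> = (\<integral>\<^sup>+x. ennreal (\<phi> x) * indicator Q x \<partial>lebesgue)"
    by (intro nn_integral_cong) (auto simp: \<phi>_def indicator_def)
  also have "\<dots> \<le> 2 * lnorm p' (indicator Q)"
  proof -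
    have "modular p (\<lambda>x. ennreal (\<phi> x) / ennreal 1) = (\<integral>\<^sup>+x. epowr (ennreal (\<phi> x)) (p x) \<partial>lebesgue)"
      using ae by (subst modular_eq) (auto simp: divide_ennreal_def)
    also have "\<dots> = (\<integral>\<^sup>+x. ennreal (1 / v) * indicator Q x \<partial>lebesgue)"
    proof (rule nn_integral_cong_AE, rule eventually_mono[OF aet])
      fix x assume x: "1 < p x \<and> p x < top \<and> 0 \<le> t x \<and> t x \<le> 1 \<and> 1 / p x = ennreal (t x) \<and> t x * enn2real (p x) = 1"
      have "exp (- c * t x) powr enn2real (p x) = exp (- c * (t x * enn2real (p x)))"
        by (simp add: powr_def mult_ac)
      also have "\<dots> = 1 / v" using x v by (simp add: c_def exp_minus field_simps)
      finally show "epowr (ennreal (\<phi> x)) (p x) = ennreal (1 / v) * indicator Q x"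
        by (auto simp: \<phi>_def epowr_ennreal indicator_def)
    qed
    also have "\<dots> = 1" using v by (simp add: nn_integral_cmult_indicator flip: ennreal_mult')
    finally have 1: "lnorm p (\<lambda>x. ennreal (\<phi> x)) \<le> 1"
      using lnorm_le[of 1 p "\<lambda>x. ennreal (\<phi> x)"] by simp
    have "(\<integral>\<^sup>+x. ennreal (\<phi> x) * indicator Q x \<partial>lebesgue) \<le>
        2 * (lnorm p (\<lambda>x. ennreal (\<phi> x)) * lnorm p' (indicator Q))"
      using 1 ae' v
      by (intro Hoelder_lnorm conj lnorm_indicator_finite le_less_trans[OF 1]) auto
    also have "\<dots> \<le> 2 * (1 * lnorm p' (indicator Q))"
      by (intro mult_left_mono mult_right_mono 1) auto
    finally show ?thesis by simp
  qed
  finally show ?thesis by (simp add: u_def)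
qed

lemma one_in_A_obtain:
  assumes D: "dyadic_lattice D" and A: "one_in_A D s"
  obtains A where "0 \<le> A" "\<And>Q. Q \<in> D \<Longrightarrow>
    lnorm s (indicator Q) * lnorm (conj_exponent s) (indicator Q) \<le> ennreal A * ennreal (vol Q)"
proof -
  let ?N = "\<lambda>Q. lnorm s (indicator Q) * lnorm (conj_exponent s) (indicator Q)"
  obtain A where A: "(SUP Q\<in>D. ?N Q / ennreal (vol Q)) = ennreal A" "0 \<le> A"
    using A by (auto simp: one_in_A_def less_top_ennreal)
  have "?N Q \<le> ennreal A * ennreal (vol Q)" if Q: "Q \<in> D" for Q
  proof -
    have v: "ennreal (vol Q) \<noteq> 0" using dyadic_lattice_vol_pos[OF D Q] by simp
    have "?N Q / ennreal (vol Q) \<le> ennreal A"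
      unfolding A(1)[symmetric] using Q by (rule SUP_upper)
    then have "?N Q / ennreal (vol Q) * ennreal (vol Q) \<le> ennreal A * ennreal (vol Q)"
      by (rule mult_right_mono) simp
    then show ?thesis using v by (simp add: ennreal_divide_times)
  qed
  then show ?thesis using A(2) that by blast
qed

text \<open>
  The \<open>A\<close> condition bounds the product of the two norms from above by a multiple of \<open>v\<close>, and
  \<open>powr_mean_le_lnorm\<close> bounds the second factor from below; their quotient is the required power.
\<close>

lemma lnorm_indicator_le_powr_mean:
  fixes p p' :: "real ^ 'n \<Rightarrow> ennreal"
  assumes conj: "conjugate_pair p p'" and Q: "Q \<in> sets lebesgue"
    and v: "emeasure lebesgue Q = ennreal v" "0 < v"
    and A: "0 \<le> A" "lnorm p (indicator Q) * lnorm p' (indicator Q) \<le> ennreal A * ennreal v"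
  shows "lnorm p (indicator Q) \<le> ennreal (2 * A * v powr mean (\<lambda>x. 1 / p x) Q)"
proof -
  let ?u = "mean (\<lambda>x. 1 / p x) Q"
  let ?w = "ennreal (v powr (1 - ?u))"
  have w: "?w \<noteq> 0" "?w \<noteq> top" using v by auto
  have "?w * lnorm p (indicator Q) \<le> (2 * lnorm p' (indicator Q)) * lnorm p (indicator Q)"
    by (intro mult_right_mono powr_mean_le_lnorm[OF conj Q v]) simp
  also have "\<dots> = 2 * (lnorm p (indicator Q) * lnorm p' (indicator Q))"
    by (simp add: mult_ac)
  also have "\<dots> \<le> 2 * (ennreal A * ennreal v)"
    by (intro mult_left_mono A) simp
  also have "\<dots> = ennreal (v powr (1 - ?u) * (2 * A * v powr ?u))"
    using v A by (simp add: powr_diff flip: ennreal_numeral ennreal_mult')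
  also have "\<dots> = ?w * ennreal (2 * A * v powr ?u)"
    using A by (intro ennreal_mult) auto
  finally show ?thesis
    using w by (subst (asm) ennreal_mult_le_mult_iff) auto
qed

section \<open>Necessity of the packing condition\<close>

text \<open>
  In the constant \<open>K\<close>, the factor \<open>8\<close> consists of one factor \<open>2\<close> from Hoelder's inequality and one from
  each of the two indicator norms, for \<open>p\<close> and for the conjugate of \<open>q\<close>.
\<close>

lemma packing_and_frac_maximal_bounded:
  fixes p q \<alpha> :: "real ^ 'n \<Rightarrow> ennreal" and D :: "(real ^ 'n) set set"
  assumes D: "dyadic_lattice D"
    and p[measurable]: "p \<in> borel_measurable lebesgue" and q[measurable]: "q \<in> borel_measurable lebesgue"
    and \<alpha>[measurable]: "\<alpha> \<in> borel_measurable lebesgue"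
    and ae: "AE x in lebesgue. 1 < p x \<and> p x \<le> q x \<and> q x < top"
    and A: "one_in_A D p" "one_in_A D q"
    and \<alpha>_eq: "AE x in lebesgue. \<alpha> x = 1 / p x - 1 / q x"
    and I: "frac_integral_bounded D \<alpha> p q"
  shows "packing_const D \<alpha> < top" "bounded_op (frac_maximal D \<alpha>) p q"
proof -
  note [measurable] = potential_measurable[OF D] frac_maximal_measurable[OF D]
  let ?p' = "conj_exponent p" and ?q' = "conj_exponent q"
  have aep: "AE x in lebesgue. 1 < p x \<and> p x < top"
    using ae by (rule eventually_mono) (auto intro: le_less_trans)
  have aeq: "AE x in lebesgue. 1 < q x \<and> q x < top"
    using ae by (rule eventually_mono) (auto intro: less_le_trans)
  have q_fin: "AE x in lebesgue. q x < top" using aeq by auto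
  have conj_p: "conjugate_pair p ?p'" by (rule conjugate_pair_conj_exponent[OF p aep])
  have conj_q: "conjugate_pair q ?q'" by (rule conjugate_pair_conj_exponent[OF q aeq])
  have [measurable]: "?q' \<in> borel_measurable lebesgue" and aeq': "AE x in lebesgue. 1 < ?q' x \<and> ?q' x < top"
    using conj_q by (auto simp: conjugate_pair_def)
  obtain c where "\<And>f. f \<in> Lspace p \<Longrightarrow>
      lnorm q (\<lambda>x. e2ennreal \<bar>frac_integral D \<alpha> f x\<bar>) \<le> ennreal c * lnorm p (\<lambda>x. ennreal \<bar>f x\<bar>)"
    using I unfolding frac_integral_bounded_def bounded_op_def by auto
  then have c: "lnorm q (potential D \<alpha> (\<lambda>x. ennreal (f x))) \<le> ennreal c * lnorm p (\<lambda>x. ennreal (f x))"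
    if "f \<in> Lspace p" "\<And>x. 0 \<le> f x" for f
  proof -
    have [measurable]: "f \<in> borel_measurable lebesgue" using that by (simp add: Lspace_def)
    have "(\<integral>\<^sup>+y\<in>Q. ennreal (f y) \<partial>lebesgue) < top" if Q: "Q \<in> D" for Q
      using Lspace_integrable_on[OF \<open>f \<in> Lspace p\<close> p aep dyadic_lattice_measurable[OF D Q]]
        dyadic_lattice_emeasure[OF D Q] \<open>\<And>x. 0 \<le> f x\<close> by simp
    then have "(\<lambda>x. e2ennreal \<bar>frac_integral D \<alpha> f x\<bar>) = potential D \<alpha> (\<lambda>x. ennreal (f x))"
      using that by (intro ext frac_integral_nonneg[OF D]) auto
    then show ?thesis
      using \<open>\<And>f. f \<in> Lspace p \<Longrightarrow> _ f \<le> _ f\<close>[OF that(1)] that(2) by simp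
  qed

  have "lnorm q (frac_maximal D \<alpha> f) \<le> ennreal c * lnorm p (\<lambda>x. ennreal \<bar>f x\<bar>)" if f: "f \<in> Lspace p" for f
  proof -
    have [measurable]: "f \<in> borel_measurable lebesgue" using f by (simp add: Lspace_def)
    have "lnorm q (frac_maximal D \<alpha> f) \<le> lnorm q (potential D \<alpha> (\<lambda>x. ennreal \<bar>f x\<bar>))"
      by (intro lnorm_mono q_fin q AE_I2 frac_maximal_le_potential[OF D]) measurable
    also have "\<dots> \<le> ennreal c * lnorm p (\<lambda>x. ennreal \<bar>f x\<bar>)"
      using f by (intro c) (auto simp: Lspace_def)
    finally show ?thesis .
  qed
  then show "bounded_op (frac_maximal D \<alpha>) p q" unfolding bounded_op_def by blast

  obtain A where A: "0 \<le> A" "\<And>Q. Q \<in> D \<Longrightarrow>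
      lnorm p (indicator Q) * lnorm ?p' (indicator Q) \<le> ennreal A * ennreal (vol Q)"
    using one_in_A_obtain[OF D assms(6)] by blast
  obtain B where B: "0 \<le> B" "\<And>Q. Q \<in> D \<Longrightarrow>
      lnorm q (indicator Q) * lnorm ?q' (indicator Q) \<le> ennreal B * ennreal (vol Q)"
    using one_in_A_obtain[OF D assms(7)] by blast
  define K where "K = 8 * max 0 c * A * B"
  have "packing_const D \<alpha> \<le> ennreal K"
    unfolding packing_const_def
  proof (rule SUP_least)
    fix Q assume Q: "Q \<in> D"
    let ?D = "{P \<in> D. P \<subseteq> Q}" and ?v = "vol Q"
    have v0: "0 < ?v" and em: "emeasure lebesgue Q = ennreal ?v" and [measurable]: "Q \<in> sets lebesgue"
      using dyadic_lattice_vol_pos[OF D Q] dyadic_lattice_emeasure[OF D Q] dyadic_lattice_measurable[OF D Q] by auto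
    \<comment> \<open>These two identities turn the exponents of the norm bounds into \<open>1 + mean \<alpha> Q\<close>.\<close>
    have mean_q: "mean (\<lambda>x. 1 / ?q' x) Q = 1 - mean (\<lambda>x. 1 / q x) Q"
    proof -
      have "mean (\<lambda>x. 1) Q = mean (\<lambda>x. 1 / q x) Q + mean (\<lambda>x. 1 / ?q' x) Q"
      proof (rule mean_add[OF _ _ _ em v0])
        have "1 / a + 1 / b = 1" if ab: "1 < a" "a < top" "1 < b" "b < top" "1 / enn2real a + 1 / enn2real b = 1"
          for a b :: ennreal
        proof -
          obtain r s where "a = ennreal r" "b = ennreal s" "1 < r" "1 < s"
            using ab by (cases a; cases b) (auto simp: one_less_ennreal)
          then show ?thesis
            using ab divide_ennreal[of 1 r] divide_ennreal[of 1 s] by (simp flip: ennreal_plus)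
        qed
        then show "AE x in lebesgue. 1 / q x + 1 / ?q' x = 1 \<and> (1 :: ennreal) \<le> 1"
          using conj_q by (auto simp: conjugate_pair_def)
      qed measurable
      moreover have "mean (\<lambda>x. 1) Q = 1"
        using v0 by (simp add: mean_def em divide_ennreal)
      ultimately show ?thesis by simp
    qed
    have mean_p: "mean (\<lambda>x. 1 / p x) Q = mean \<alpha> Q + mean (\<lambda>x. 1 / q x) Q"
    proof (rule mean_add[OF _ _ _ em v0])
      show "AE x in lebesgue. \<alpha> x + 1 / q x = 1 / p x \<and> 1 / p x \<le> 1"
        using ae \<alpha>_eq
      proof eventually_elim
        case (elim x)
        then obtain r s where rs: "p x = ennreal r" "q x = ennreal s" "1 < r" "r \<le> s"
          by (cases "p x"; cases "q x") (auto simp: one_less_ennreal top_unique)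
        then have "1 / p x = ennreal (1 / r)" "1 / q x = ennreal (1 / s)"
          using divide_ennreal[of 1 r] divide_ennreal[of 1 s] by auto
        moreover have "1 / s \<le> 1 / r" "1 / r \<le> 1" using rs by (auto simp: field_simps)
        ultimately show ?case
          using elim by (simp add: diff_add_cancel_ennreal ennreal_leI ennreal_le_1)
      qed
    qed measurable
    have Np: "lnorm p (indicator Q) \<le> ennreal (2 * A * ?v powr mean (\<lambda>x. 1 / p x) Q)"
      using A Q by (intro lnorm_indicator_le_powr_mean[OF conj_p _ em v0]) auto
    have Nq: "lnorm ?q' (indicator Q) \<le> ennreal (2 * B * ?v powr mean (\<lambda>x. 1 / ?q' x) Q)"
      using B Q by (intro lnorm_indicator_le_powr_mean[OF conjugate_pair_sym[OF conj_q] _ em v0]) (auto simp: mult.commute)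
    let ?T = "potential D \<alpha> (indicator Q)"
    have ind: "(\<lambda>x. ennreal (indicator Q x)) = indicator Q" by (auto simp: indicator_def)
    have "(indicator Q :: real ^ 'n \<Rightarrow> real) \<in> Lspace p"
      using lnorm_indicator_finite[OF p _ aep, of Q] em by (simp add: Lspace_def ind)
    then have T: "lnorm q ?T \<le> ennreal (max 0 c) * lnorm p (indicator Q)"
      using c[of "indicator Q"] by (simp add: ind ennreal_max_0)
    have T_fin: "lnorm q ?T < top"
      by (rule le_less_trans[OF T]) (simp add: ennreal_mult_less_top lnorm_indicator_finite[OF p _ aep] em)
    have N_fin: "lnorm ?q' (indicator Q) < top"
      by (rule lnorm_indicator_finite[OF _ _ aeq']) (simp_all add: em)
    \<comment> \<open>Since \<open>P\<close> lies in \<open>Q\<close>, the indicator of \<open>Q\<close> integrates over \<open>P\<close> to the full volume of \<open>P\<close>.\<close>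
    have coeff: "indicator P x * ennreal (vol P powr mean \<alpha> P) \<le>
        indicator P x * ((\<integral>\<^sup>+y\<in>P. indicator Q y \<partial>lebesgue) / ennreal (vol P powr (1 - mean \<alpha> P)))"
      if P: "P \<in> ?D" for P x
    proof -
      have v: "0 < vol P" using P dyadic_lattice_vol_pos[OF D] by auto
      have [measurable]: "P \<in> sets lebesgue" using P dyadic_lattice_measurable[OF D] by auto
      have "(\<integral>\<^sup>+y\<in>P. indicator Q y \<partial>lebesgue) = (\<integral>\<^sup>+y. indicator P y \<partial>lebesgue)"
        using P by (intro nn_integral_cong) (auto simp: indicator_def)
      also have "\<dots> = ennreal (vol P)"
        using P dyadic_lattice_emeasure[OF D, of P] by simp
      finally show ?thesis using v by (simp add: divide_ennreal powr_diff)
    qed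
    have "(\<Sum>\<^sub>\<infinity>P\<in>?D. ennreal (vol P powr (1 + mean \<alpha> P))) =
        (\<Sum>\<^sub>\<infinity>P\<in>?D. \<integral>\<^sup>+x. indicator P x * ennreal (vol P powr mean \<alpha> P) \<partial>lebesgue)"
    proof (rule infsum_cong)
      fix P assume P: "P \<in> ?D"
      then have "0 < vol P" "emeasure lebesgue P = ennreal (vol P)" "P \<in> sets lebesgue"
        using dyadic_lattice_vol_pos[OF D] dyadic_lattice_emeasure[OF D] dyadic_lattice_measurable[OF D] by auto
      then show "ennreal (vol P powr (1 + mean \<alpha> P)) = (\<integral>\<^sup>+x. indicator P x * ennreal (vol P powr mean \<alpha> P) \<partial>lebesgue)"
        by (simp add: nn_integral_multc powr_add flip: ennreal_mult')
    qed
    also have "\<dots> = (\<integral>\<^sup>+x. (\<Sum>\<^sub>\<infinity>P\<in>?D. indicator P x * ennreal (vol P powr mean \<alpha> P)) \<partial>lebesgue)"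
      using dyadic_lattice_measurable[OF D] countable_dyadic_lattice[OF D]
      by (intro nn_integral_infsum[symmetric] borel_measurable_times borel_measurable_indicator)
        (auto intro: countable_subset)
    also have "\<dots> \<le> (\<integral>\<^sup>+x. ?T x * indicator Q x \<partial>lebesgue)"
    proof (rule nn_integral_mono)
      fix x
      show "(\<Sum>\<^sub>\<infinity>P\<in>?D. indicator P x * ennreal (vol P powr mean \<alpha> P)) \<le> ?T x * indicator Q x"
      proof (cases "x \<in> Q")
        case True
        have "(\<Sum>\<^sub>\<infinity>P\<in>?D. indicator P x * ennreal (vol P powr mean \<alpha> P)) \<le>
            (\<Sum>\<^sub>\<infinity>P\<in>?D. indicator P x * ((\<integral>\<^sup>+y\<in>P. indicator Q y \<partial>lebesgue) / ennreal (vol P powr (1 - mean \<alpha> P))))"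
          by (intro infsum_ennreal_mono coeff)
        also have "\<dots> \<le> ?T x"
          unfolding potential_def by (intro infsum_ennreal_mono_set) auto
        finally show ?thesis using True by simp
      next
        case False
        then have "(\<Sum>\<^sub>\<infinity>P\<in>?D. indicator P x * ennreal (vol P powr mean \<alpha> P)) = 0"
          by (intro infsum_0) (auto simp: indicator_def)
        then show ?thesis by simp
      qed
    qed
    also have "\<dots> \<le> 2 * (lnorm q ?T * lnorm ?q' (indicator Q))"
      by (intro Hoelder_lnorm conj_q T_fin N_fin) measurable
    also have "\<dots> \<le> 2 * ((ennreal (max 0 c) * ennreal (2 * A * ?v powr mean (\<lambda>x. 1 / p x) Q)) *
        ennreal (2 * B * ?v powr mean (\<lambda>x. 1 / ?q' x) Q))"
      by (intro mult_left_mono mult_mono Nq order_trans[OF T] Np) auto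
    also have "\<dots> = ennreal (K * (?v powr mean (\<lambda>x. 1 / p x) Q * ?v powr mean (\<lambda>x. 1 / ?q' x) Q))"
      using A(1) B(1) by (simp add: K_def mult_ac flip: ennreal_numeral ennreal_mult')
    also have "?v powr mean (\<lambda>x. 1 / p x) Q * ?v powr mean (\<lambda>x. 1 / ?q' x) Q = ?v powr (1 + mean \<alpha> Q)"
      by (simp add: mean_p mean_q add.commute flip: powr_add)
    also have "ennreal (K * ?v powr (1 + mean \<alpha> Q)) = ennreal K * ennreal (?v powr (1 + mean \<alpha> Q))"
      by (rule ennreal_mult'') simp
    finally show "(\<Sum>\<^sub>\<infinity>P\<in>?D. ennreal (vol P powr (1 + mean \<alpha> P))) / ennreal (?v powr (1 + mean \<alpha> Q)) \<le> ennreal K"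
      using v0 by (intro divide_le_posI_ennreal) (simp_all add: mult.commute)
  qed
  then show "packing_const D \<alpha> < top" by (rule le_less_trans) simp
qed

section \<open>Boundedness of the dyadic fractional integral\<close>

theorem theorem1p3:
  fixes p q \<alpha> :: "real ^ 'n \<Rightarrow> ennreal" and D :: "(real ^ 'n) set set"
  assumes "p \<in> exponents" and "q \<in> exponents" and "(\<lambda>x. 1 / \<alpha> x) \<in> exponents"
    and "AE x in lebesgue. 1 < p x \<and> p x \<le> q x \<and> q x < top"
    and "dyadic_lattice D"
  shows "(bounded_op (maximal D) (conj_exponent q) (conj_exponent q) \<longrightarrow>
          one_in_A D (\<lambda>x. 1 / \<alpha> x) \<longrightarrow>
          packing_const D \<alpha> < top \<longrightarrow>
          bounded_op (frac_maximal D \<alpha>) p q \<longrightarrow>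
          frac_integral_bounded D \<alpha> p q)
       \<and> (one_in_A D p \<longrightarrow> one_in_A D q \<longrightarrow>
          (AE x in lebesgue. \<alpha> x = 1 / p x - 1 / q x) \<longrightarrow>
          frac_integral_bounded D \<alpha> p q \<longrightarrow>
          packing_const D \<alpha> < top \<and> bounded_op (frac_maximal D \<alpha>) p q)"
proof -
  have p: "p \<in> borel_measurable lebesgue" and q: "q \<in> borel_measurable lebesgue"
    and "(\<lambda>x. 1 / \<alpha> x) \<in> borel_measurable lebesgue"
    using assms(1-3) by (auto simp: exponents_def)
  then have "(\<lambda>x. 1 / (1 / \<alpha> x)) \<in> borel_measurable lebesgue" by measurable
  then have \<alpha>: "\<alpha> \<in> borel_measurable lebesgue" by simp
  have ae_p: "AE x in lebesgue. 1 < p x \<and> p x < top"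
    using assms(4) by (rule eventually_mono) (auto intro: le_less_trans)
  have ae_q: "AE x in lebesgue. 1 < q x \<and> q x < top"
    using assms(4) by (rule eventually_mono) (auto intro: less_le_trans)
  show ?thesis
    using frac_integral_bounded_if_packing[OF assms(5) p q ae_p ae_q, of \<alpha>]
      packing_and_frac_maximal_bounded[OF assms(5) p q \<alpha> assms(4)]
    by blast
qed

end
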